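(* Let $\mu$ be a probability measure on a countable group $G$. Suppose that the semigroup $\langle \mathrm{supp}(\mu)\rangle_{+}$ generated by the support of $\mu$ contains a finitely generated subgroup of at least cubic growth. Let $\{\mu_k\}_{k\ge 1}$ be a sequence of probability measures on $G$ such that $\lim_{k\to\infty}\mu_k(g)=\mu(g)$ for every $g\in G$. Then $\lim_{k\to\infty}p_{\mathrm{esc}}(\mu_k)=p_{\mathrm{esc}}(\mu)$.
   Context: For a probability measure $\mu$ on a countable group $G$, the $\mu$-random walk is $w_0=e_G$, $w_n=g_1g_2\cdots g_n$ with $\{g_i\}_{i\ge1}$ i.i.d. of law $\mu$. The escape probability is $p_{\mathrm{esc}}(\mu)=\mathbb{P}(w_n\neq e_G\text{ for every }n\ge 1)$. A group $H$ has at least cubic growth if there is a finite symmetric subset $S\subseteq H$ such that $\liminf_{n\to\infty}|S^n|/n^3>0$, where $S^n$ is the set of products of $n$ elements of $S$. *)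

theory Defs
  imports "HOL-Algebra.Algebra" "HOL-Probability.Probability"
begin

text \<open>Groups are in the sense of HOL-Algebra. A countable group carries the discrete
  sigma-algebra, so a probability measure on it is a probability space whose measurable sets are
  all subsets of the carrier.\<close>

definition prob_measure_on :: "('a, 'b) monoid_scheme \<Rightarrow> 'a measure \<Rightarrow> bool" where
  "prob_measure_on G \<mu> \<longleftrightarrow> prob_space \<mu> \<and> sets \<mu> = Pow (carrier G)"

definition supp :: "'a measure \<Rightarrow> 'a set" where
  "supp \<mu> = {g \<in> space \<mu>. measure \<mu> {g} > 0}"

text \<open>The increment written \<open>g\<^sub>i\<close> for \<open>i \<ge> 1\<close> is \<open>g (i - 1)\<close> here, so that
  \<open>walk G g n = g 0 \<otimes> \<dots> \<otimes> g (n - 1)\<close>.\<close>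

primrec walk :: "('a, 'b) monoid_scheme \<Rightarrow> (nat \<Rightarrow> 'a) \<Rightarrow> nat \<Rightarrow> 'a" where
  "walk G g 0 = \<one>\<^bsub>G\<^esub>"
| "walk G g (Suc n) = walk G g n \<otimes>\<^bsub>G\<^esub> g n"

text \<open>The i.i.d. increments are realised as the coordinates of the infinite product space.\<close>

definition escape_prob :: "('a, 'b) monoid_scheme \<Rightarrow> 'a measure \<Rightarrow> real" where
  "escape_prob G \<mu> =
     \<P>(g in (\<Pi>\<^sub>M i\<in>(UNIV :: nat set). \<mu>). \<forall>n\<ge>1. walk G g n \<noteq> \<one>\<^bsub>G\<^esub>)"

inductive_set semigroup_generated :: "('a, 'b) monoid_scheme \<Rightarrow> 'a set \<Rightarrow> 'a set"
  for G and A where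
  base: "a \<in> A \<Longrightarrow> a \<in> semigroup_generated G A"
| mult: "x \<in> semigroup_generated G A \<Longrightarrow> y \<in> semigroup_generated G A
    \<Longrightarrow> x \<otimes>\<^bsub>G\<^esub> y \<in> semigroup_generated G A"

definition finitely_generated_group :: "('a, 'b) monoid_scheme \<Rightarrow> bool" where
  "finitely_generated_group H \<longleftrightarrow>
     (\<exists>A. finite A \<and> A \<subseteq> carrier H \<and> generate H A = carrier H)"

primrec set_power :: "('a, 'b) monoid_scheme \<Rightarrow> 'a set \<Rightarrow> nat \<Rightarrow> 'a set" where
  "set_power H S 0 = {\<one>\<^bsub>H\<^esub>}"
| "set_power H S (Suc n) = set_power H S n <#>\<^bsub>H\<^esub> S"

definition at_least_cubic_growth :: "('a, 'b) monoid_scheme \<Rightarrow> bool" where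
  "at_least_cubic_growth H \<longleftrightarrow>
     (\<exists>S. finite S \<and> S \<subseteq> carrier H \<and> (\<forall>s\<in>S. inv\<^bsub>H\<^esub> s \<in> S) \<and>
        liminf (\<lambda>n. ereal (real (card (set_power H S n)) / real n ^ 3)) > 0)"

end

theory Submission
  imports Defs
begin

text \<open>
  Why the theorem holds. Cutting a trajectory at its last visit to the identity shows that the
  escape probability times the Green function \<open>\<Sum>n. \<P>(w\<^sub>n = \<one>)\<close> is \<open>1\<close> whenever
  that series converges (\<open>escape_prob_times_green\<close>). It therefore suffices that the Green
  function is continuous along the sequence. Each single return probability is continuous, because
  pointwise convergence of probability mass functions is convergence in \<open>\<ell>\<^sup>1\<close>
  (\<open>pmf_walk_tendsto\<close>). What remains is a bound on the tails of the series that is uniform in the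
  measures close to \<open>\<mu>\<close> and tends to zero (\<open>sum_return_prob_le\<close>); this is where cubic growth enters.

  The finitely many elements of a set of cubic growth are products of boundedly many elements of a
  finite set \<open>F\<close> in the support of \<open>\<mu>\<close>. Measures near \<open>\<mu>\<close> give all elements of \<open>F\<close> mass at
  least some fixed \<open>a > 0\<close>, and all constants below depend on the measure through \<open>a\<close> alone.
  Different products may need different numbers of factors, and the walk may be
  periodic; replacing it by the lazy walk, which stays put with probability \<open>1/2\<close>, removes both
  obstacles, since \<open>F\<close> may then be enlarged by the identity. The lazy walk at
  time \<open>n\<close> is the original walk at a binomial time, which lets tails of the original Green series be
  bounded by tails of the lazy one (\<open>sum_le_sum_binomial_average\<close>).

  For the lazy walk let \<open>f\<close> be the mass function at time \<open>n\<close> and \<open>u n = \<Sum>x. f(x)\<^sup>2\<close>. One step decreases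
  \<open>u n\<close> by at least a quarter of the mean of \<open>\<Sum>x. (f(x) - f(x inv g))\<^sup>2\<close> over the increment \<open>g\<close>
  (\<open>square_sum_lazy_step\<close>), so that \<open>f\<close> is almost invariant under right translation by elements of
  \<open>F\<close>, hence under products of \<open>r\<close> of them with a loss of a factor \<open>r\<^sup>2\<close>
  (\<open>shift_diff_set_power\<close>). A function of total mass \<open>1\<close> that is almost invariant under
  \<open>c r\<^sup>3\<close> translations has a square sum of order at most \<open>1/(c r\<^sup>3)\<close> up to the error
  (\<open>square_sum_le_shift_diff\<close>). Together this is the Nash inequality
  \<open>u n \<le> A r\<^sup>2 (u n - u (n+1)) + B / r\<^sup>3\<close> for all \<open>r \<ge> 1\<close>. Choosing \<open>r\<close> of order \<open>u n\<close> to the power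
  \<open>-1/3\<close> turns it into a telescoping bound for the tails of \<open>\<Sum>n. u n\<close>
  (\<open>nash_recursion_sum\<close>), and the return probabilities of the lazy walk are at most
  \<open>u (n div 2)\<close> (\<open>pmf_walk_one_le\<close>).
\<close>

section \<open>The walk and its lazy version\<close>

primrec walk_pmf :: "('a, 'b) monoid_scheme \<Rightarrow> 'a pmf \<Rightarrow> nat \<Rightarrow> 'a pmf" where
  "walk_pmf G p 0 = return_pmf \<one>\<^bsub>G\<^esub>"
| "walk_pmf G p (Suc n) = bind_pmf (walk_pmf G p n) (\<lambda>x. map_pmf (\<lambda>g. x \<otimes>\<^bsub>G\<^esub> g) p)"

definition lazy_pmf :: "('a, 'b) monoid_scheme \<Rightarrow> 'a pmf \<Rightarrow> 'a pmf" where
  "lazy_pmf G p = bind_pmf (bernoulli_pmf (1/2)) (\<lambda>b. if b then p else return_pmf \<one>\<^bsub>G\<^esub>)"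

context group
begin

lemma set_walk_pmf: "set_pmf p \<subseteq> carrier G \<Longrightarrow> set_pmf (walk_pmf G p n) \<subseteq> carrier G"
  by (induction n) auto

lemma set_lazy_pmf: "set_pmf p \<subseteq> carrier G \<Longrightarrow> set_pmf (lazy_pmf G p) \<subseteq> carrier G"
  by (auto simp: lazy_pmf_def split: if_splits)

lemma pmf_map_mult_right:
  assumes "set_pmf q \<subseteq> carrier G" "g \<in> carrier G" "x \<in> carrier G"
  shows "pmf (map_pmf (\<lambda>y. y \<otimes> g) q) x = pmf q (x \<otimes> inv g)"
proof -
  have "pmf (map_pmf (\<lambda>y. y \<otimes> g) q) x = measure q ((\<lambda>y. y \<otimes> g) -` {x})"
    by (simp add: pmf_map)
  also have "\<dots> = measure q {x \<otimes> inv g}"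
    using assms
    by (intro measure_pmf.finite_measure_eq_AE AE_pmfI) (auto simp: m_assoc subset_iff)
  finally show ?thesis by (simp add: measure_pmf_single)
qed

lemma pmf_map_mult_left:
  assumes "set_pmf q \<subseteq> carrier G" "y \<in> carrier G" "x \<in> carrier G"
  shows "pmf (map_pmf (\<lambda>g. y \<otimes> g) q) x = pmf q (inv y \<otimes> x)"
proof -
  have "pmf (map_pmf (\<lambda>g. y \<otimes> g) q) x = measure q ((\<lambda>g. y \<otimes> g) -` {x})"
    by (simp add: pmf_map)
  also have "\<dots> = measure q {inv y \<otimes> x}"
    using assms
    by (intro measure_pmf.finite_measure_eq_AE AE_pmfI)
      (auto simp: m_assoc[symmetric] subset_iff)
  finally show ?thesis by (simp add: measure_pmf_single)
qed

text \<open>Conditioning on the last increment rather than on the position before it: the right-hand side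
  then averages translates of one fixed function, which is what the energy estimate needs.\<close>

lemma pmf_walk_Suc:
  assumes p: "set_pmf p \<subseteq> carrier G" and x: "x \<in> carrier G"
  shows "ennreal (pmf (walk_pmf G p (Suc n)) x) = (\<integral>\<^sup>+g. pmf (walk_pmf G p n) (x \<otimes> inv g) \<partial>p)"
proof -
  have "walk_pmf G p (Suc n) = bind_pmf p (\<lambda>g. map_pmf (\<lambda>x. x \<otimes> g) (walk_pmf G p n))"
    by (simp add: map_pmf_def) (rule bind_commute_pmf)
  then have "ennreal (pmf (walk_pmf G p (Suc n)) x)
      = (\<integral>\<^sup>+g. pmf (map_pmf (\<lambda>x. x \<otimes> g) (walk_pmf G p n)) x \<partial>p)"
    by (simp only: ennreal_pmf_bind)
  also have "\<dots> = (\<integral>\<^sup>+g. pmf (walk_pmf G p n) (x \<otimes> inv g) \<partial>p)"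
    using p x set_walk_pmf[OF p]
    by (intro nn_integral_cong_AE AE_pmfI) (auto simp: pmf_map_mult_right subset_iff)
  finally show ?thesis .
qed

text \<open>The Markov property. The recursion appends increments on the right, so associativity is
  needed, and it is available only on the support.\<close>

lemma walk_pmf_add:
  assumes p: "set_pmf p \<subseteq> carrier G"
  shows "walk_pmf G p (n + k) = bind_pmf (walk_pmf G p n) (\<lambda>y. map_pmf (\<lambda>z. y \<otimes> z) (walk_pmf G p k))"
proof (induction k)
  case 0
  have "bind_pmf (walk_pmf G p n) (\<lambda>y. return_pmf (y \<otimes> \<one>)) = bind_pmf (walk_pmf G p n) return_pmf"
    using set_walk_pmf[OF p, of n] by (intro bind_pmf_cong) auto
  then show ?case by (simp add: bind_return_pmf')
next
  case (Suc k)
  have "walk_pmf G p (n + Suc k)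
      = bind_pmf (walk_pmf G p n) (\<lambda>y. bind_pmf (walk_pmf G p k) (\<lambda>z. map_pmf (\<lambda>g. y \<otimes> z \<otimes> g) p))"
    by (simp add: Suc bind_assoc_pmf bind_map_pmf)
  also have "\<dots> = bind_pmf (walk_pmf G p n)
      (\<lambda>y. bind_pmf (walk_pmf G p k) (\<lambda>z. map_pmf (\<lambda>g. y \<otimes> (z \<otimes> g)) p))"
    using set_walk_pmf[OF p] p
    by (intro bind_pmf_cong map_pmf_cong refl) (auto simp: m_assoc subset_iff)
  finally show ?case by (simp add: map_bind_pmf pmf.map_comp o_def)
qed

lemma pmf_walk_add:
  assumes p: "set_pmf p \<subseteq> carrier G" and x: "x \<in> carrier G"
  shows "ennreal (pmf (walk_pmf G p (n + k)) x)
    = (\<integral>\<^sup>+y. pmf (walk_pmf G p k) (inv y \<otimes> x) \<partial>walk_pmf G p n)"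
  unfolding walk_pmf_add[OF p] ennreal_pmf_bind
  using set_walk_pmf[OF p] x
  by (intro nn_integral_cong_AE AE_pmfI) (auto simp: pmf_map_mult_left subset_iff)

text \<open>Each lazy step makes a genuine step according to an independent fair coin, so the number of
  genuine steps up to time \<open>n\<close> is binomial.\<close>

lemma walk_lazy_pmf:
  assumes p: "set_pmf p \<subseteq> carrier G"
  shows "walk_pmf G (lazy_pmf G p) n = bind_pmf (binomial_pmf n (1/2)) (walk_pmf G p)"
proof (induction n)
  case 0
  then show ?case by (simp add: binomial_pmf_0 bind_return_pmf)
next
  case (Suc n)
  have step: "bind_pmf (walk_pmf G p k) (\<lambda>x. map_pmf (\<lambda>g. x \<otimes> g) (if b then p else return_pmf \<one>))
      = walk_pmf G p ((if b then 1 else 0) + k)" for b k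
  proof (cases b)
    case False
    have "bind_pmf (walk_pmf G p k) (\<lambda>x. return_pmf (x \<otimes> \<one>)) = bind_pmf (walk_pmf G p k) return_pmf"
      using set_walk_pmf[OF p, of k] by (intro bind_pmf_cong) auto
    with False show ?thesis by (simp add: bind_return_pmf')
  qed simp
  let ?B = "bernoulli_pmf (1/2)" and ?N = "binomial_pmf n (1/2)"
  have "walk_pmf G (lazy_pmf G p) (Suc n)
    = bind_pmf ?N (\<lambda>k. bind_pmf (walk_pmf G p k) (\<lambda>x. bind_pmf ?B
        (\<lambda>b. map_pmf (\<lambda>g. x \<otimes> g) (if b then p else return_pmf \<one>))))"
    by (simp add: Suc bind_assoc_pmf) (simp add: lazy_pmf_def map_bind_pmf)
  \<comment> \<open>The coin of the last step is moved to the front, where it completes the binomial variable.\<close>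
  also have "\<dots> = bind_pmf ?N (\<lambda>k. bind_pmf ?B (\<lambda>b. bind_pmf (walk_pmf G p k)
        (\<lambda>x. map_pmf (\<lambda>g. x \<otimes> g) (if b then p else return_pmf \<one>))))"
    by (subst bind_commute_pmf) simp
  also have "\<dots> = bind_pmf ?B (\<lambda>b. bind_pmf ?N (\<lambda>k. walk_pmf G p ((if b then 1 else 0) + k)))"
    unfolding step by (rule bind_commute_pmf)
  also have "\<dots> = bind_pmf (binomial_pmf (Suc n) (1/2)) (walk_pmf G p)"
    by (simp add: binomial_pmf_Suc bind_assoc_pmf bind_return_pmf)
  finally show ?case .
qed

lemma pmf_walk_lazy:
  assumes p: "set_pmf p \<subseteq> carrier G"
  shows "pmf (walk_pmf G (lazy_pmf G p) n) x = (\<Sum>m\<le>n. (n choose m) / 2 ^ n * pmf (walk_pmf G p m) x)"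
proof -
  have "pmf (walk_pmf G (lazy_pmf G p) n) x
      = (\<Sum>m\<le>n. pmf (binomial_pmf n (1/2)) m *\<^sub>R pmf (walk_pmf G p m) x)"
    unfolding walk_lazy_pmf[OF p] pmf_bind
    by (intro integral_measure_pmf) (auto simp: set_pmf_binomial_eq)
  also have "\<dots> = (\<Sum>m\<le>n. (n choose m) / 2 ^ n * pmf (walk_pmf G p m) x)"
    by (intro sum.cong) (auto simp: power_add[symmetric] power_divide)
  finally show ?thesis .
qed

end

section \<open>Sets of cubic growth inside a generated semigroup\<close>

text \<open>The product of sets uses only the multiplication, so powers computed in a subgroup and in the
  whole group agree.\<close>

lemma set_power_restrict: "set_power (G\<lparr>carrier := H\<rparr>) S n = set_power G S n"
  by (induction n) (auto simp: set_mult_def)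

lemma set_power_finite_nonempty:
  assumes "finite S" "S \<noteq> {}"
  shows "finite (set_power G S n)" "set_power G S n \<noteq> {}"
proof -
  have "finite (set_power G S n) \<and> set_power G S n \<noteq> {}"
    by (induction n) (use assms in \<open>auto simp: set_mult_def\<close>)
  then show "finite (set_power G S n)" "set_power G S n \<noteq> {}" by auto
qed

text \<open>The lower limit gives the bound for large \<open>n\<close>. It also forces \<open>S\<close> to be nonempty, so all
  powers have at least one element and a smaller constant covers the remaining \<open>n\<close>.\<close>

lemma at_least_cubic_growth_card:
  assumes "at_least_cubic_growth H"
  shows "\<exists>S c. finite S \<and> S \<subseteq> carrier H \<and> S \<noteq> {} \<and> c > 0 \<and>
    (\<forall>n\<ge>1. c * real n ^ 3 \<le> real (card (set_power H S n)))"
proof -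
  let ?f = "\<lambda>S n. real (card (set_power H S n))"
  obtain S where S: "finite S" "S \<subseteq> carrier H"
    and lim: "liminf (\<lambda>n. ereal (?f S n / real n ^ 3)) > 0"
    using assms by (auto simp: at_least_cubic_growth_def)
  from lim obtain c0 where c0: "0 < ereal c0" "ereal c0 < liminf (\<lambda>n. ereal (?f S n / real n ^ 3))"
    using ereal_dense2[OF lim] by blast
  from less_LiminfD[OF c0(2)] obtain N where N: "\<And>n. n \<ge> N \<Longrightarrow> c0 < ?f S n / real n ^ 3"
    by (auto simp: eventually_sequentially)
  have ne: "S \<noteq> {}"
  proof
    assume "S = {}"
    then have "?f S (Suc N) = 0" by (simp add: set_mult_def)
    with N[of "Suc N"] c0(1) show False by simp
  qed
  define c where "c = min c0 (1 / real (Suc N) ^ 3)"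
  show ?thesis
  proof (intro exI[of _ S] exI[of _ c] conjI allI impI)
    show "c > 0" using c0(1) by (simp add: c_def)
    fix n :: nat assume n: "n \<ge> 1"
    show "c * real n ^ 3 \<le> ?f S n"
    proof (cases "n \<ge> N")
      case True
      have "c * real n ^ 3 \<le> c0 * real n ^ 3" by (intro mult_right_mono) (auto simp: c_def)
      also have "\<dots> \<le> ?f S n" using N[OF True] n by (simp add: field_simps)
      finally show ?thesis .
    next
      case False
      have "c * real n ^ 3 \<le> 1 / real (Suc N) ^ 3 * real (Suc N) ^ 3"
        using False by (intro mult_mono power_mono) (auto simp: c_def)
      also have "\<dots> = 1" by simp
      also have "1 \<le> ?f S n"
        using set_power_finite_nonempty[OF S(1) ne, of H n] by (simp add: Suc_le_eq card_gt_0_iff)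
      finally show ?thesis .
    qed
  qed (use S ne in auto)
qed

context group
begin

lemma set_power_mono: "S \<subseteq> T \<Longrightarrow> set_power G S n \<subseteq> set_power G T n"
  by (induction n) (auto simp: set_mult_def)

lemma set_power_subset: "T \<subseteq> carrier G \<Longrightarrow> set_power G T r \<subseteq> carrier G"
  by (induction r) (auto simp: set_mult_def)

lemma set_power_add:
  assumes T: "T \<subseteq> carrier G" and x: "x \<in> set_power G T m" and y: "y \<in> set_power G T n"
  shows "x \<otimes> y \<in> set_power G T (m + n)"
  using y
proof (induction n arbitrary: y)
  case 0
  then show ?case using x subsetD[OF set_power_subset[OF T] x] by simp
next
  case (Suc n)
  then obtain z t where z: "z \<in> set_power G T n" and t: "t \<in> T" and y: "y = z \<otimes> t"
    by (auto simp: set_mult_def)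
  have "x \<otimes> y = (x \<otimes> z) \<otimes> t"
    using x z t T set_power_subset[OF T] unfolding y by (intro m_assoc[symmetric]) auto
  with Suc.IH[OF z] t show ?case by (auto simp: set_mult_def)
qed

lemma set_power_insert_one_mono:
  assumes "T \<subseteq> carrier G" "\<one> \<in> T" "m \<le> n"
  shows "set_power G T m \<subseteq> set_power G T n"
proof (rule lift_Suc_mono_le[OF _ assms(3)])
  fix k
  show "set_power G T k \<subseteq> set_power G T (Suc k)"
    using set_power_subset[OF assms(1), of k] assms(2) by (force simp: set_mult_def)
qed

text \<open>Adjoining the identity to the generators makes the powers increase with the exponent, which
  lets elements with different word lengths share one exponent below.\<close>

lemma semigroup_generated_in_set_power:
  assumes A: "A \<subseteq> carrier G" and x: "x \<in> semigroup_generated G A"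
  shows "\<exists>F n. finite F \<and> F \<subseteq> A \<and> x \<in> set_power G (insert \<one> F) n"
  using x
proof induction
  case (base a)
  then have "a \<in> set_power G (insert \<one> {a}) 1"
    using A by (force simp: set_mult_def)
  with base show ?case by (intro exI[of _ "{a}"] exI[of _ 1]) auto
next
  case (mult x y)
  then obtain E m F n where E: "finite E" "E \<subseteq> A" "x \<in> set_power G (insert \<one> E) m"
    and F: "finite F" "F \<subseteq> A" "y \<in> set_power G (insert \<one> F) n" by blast
  let ?T = "insert \<one> (E \<union> F)"
  have "x \<in> set_power G ?T m" "y \<in> set_power G ?T n"
    using E(3) F(3) set_power_mono[of "insert \<one> E" ?T m] set_power_mono[of "insert \<one> F" ?T n] by auto
  then have "x \<otimes> y \<in> set_power G ?T (m + n)"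
    using A E F by (intro set_power_add) auto
  with E F show ?case by (intro exI[of _ "E \<union> F"] exI[of _ "m + n"]) auto
qed

lemma finite_subset_semigroup_generated:
  assumes A: "A \<subseteq> carrier G" and S: "finite S" "S \<subseteq> semigroup_generated G A"
  shows "\<exists>F n. finite F \<and> F \<subseteq> A \<and> n > 0 \<and> S \<subseteq> set_power G (insert \<one> F) n"
  using S
proof (induction S)
  case empty
  then show ?case by (intro exI[of _ "{}"] exI[of _ 1]) auto
next
  case (insert x S)
  then obtain F n where F: "finite F" "F \<subseteq> A" "n > 0" "S \<subseteq> set_power G (insert \<one> F) n" by auto
  from insert.prems semigroup_generated_in_set_power[OF A, of x]
  obtain E m where E: "finite E" "E \<subseteq> A" "x \<in> set_power G (insert \<one> E) m" by auto
  let ?T = "insert \<one> (E \<union> F)"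
  have T: "?T \<subseteq> carrier G" using A E F by auto
  have "set_power G (insert \<one> E) m \<subseteq> set_power G ?T (m + n)"
    using set_power_mono[of "insert \<one> E" ?T m] set_power_insert_one_mono[OF T, of m "m + n"] by auto
  moreover have "set_power G (insert \<one> F) n \<subseteq> set_power G ?T (m + n)"
    using set_power_mono[of "insert \<one> F" ?T n] set_power_insert_one_mono[OF T, of n "m + n"] by auto
  ultimately show ?case
    using E F by (intro exI[of _ "E \<union> F"] exI[of _ "m + n"]) auto
qed

lemma set_power_mult_subset:
  assumes T: "T \<subseteq> carrier G" and S: "S \<subseteq> set_power G T K"
  shows "set_power G S r \<subseteq> set_power G T (K * r)"
proof (induction r)
  case (Suc r)
  show ?case
  proof
    fix x assume "x \<in> set_power G S (Suc r)"
    then obtain y s where "y \<in> set_power G S r" "s \<in> S" "x = y \<otimes> s" by (auto simp: set_mult_def)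
    with Suc S have "x \<in> set_power G T (K * r + K)" by (auto intro: set_power_add[OF T])
    then show "x \<in> set_power G T (K * Suc r)" by (simp add: add.commute)
  qed
qed simp

end

section \<open>Square sums along the lazy walk\<close>

text \<open>Both sums are taken in the extended nonnegative reals: sums and integrals can then be
  interchanged freely, and all estimates are written without subtraction.\<close>

definition square_sum :: "('a, 'b) monoid_scheme \<Rightarrow> ('a \<Rightarrow> real) \<Rightarrow> ennreal" where
  "square_sum G f = (\<integral>\<^sup>+x. ennreal ((f x)\<^sup>2) \<partial>count_space (carrier G))"

definition shift_diff :: "('a, 'b) monoid_scheme \<Rightarrow> ('a \<Rightarrow> real) \<Rightarrow> 'a \<Rightarrow> ennreal" where
  "shift_diff G f g =
     (\<integral>\<^sup>+x. ennreal ((f x - f (x \<otimes>\<^bsub>G\<^esub> inv\<^bsub>G\<^esub> g))\<^sup>2) \<partial>count_space (carrier G))"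

lemma two_times_ennreal: "2 * ennreal z = ennreal (2 * z)"
  by (simp add: ennreal_mult')

lemma nn_integral_pmf_on:
  assumes "set_pmf q \<subseteq> A"
  shows "(\<integral>\<^sup>+x. h x \<partial>q) = (\<integral>\<^sup>+x. ennreal (pmf q x) * h x \<partial>count_space A)"
  unfolding nn_integral_measure_pmf nn_integral_count_space_indicator[of A] using assms
  by (subst nn_integral_count_space_indicator)
    (auto intro!: nn_integral_cong simp: indicator_def set_pmf_eq subset_iff split: if_splits)

lemma square_nn_integral_pmf_le: "(\<integral>\<^sup>+x. h x \<partial>measure_pmf q)\<^sup>2 \<le> (\<integral>\<^sup>+x. (h x)\<^sup>2 \<partial>measure_pmf q)"
  using Cauchy_Schwarz_nn_integral[of h "measure_pmf q" "\<lambda>_. 1"]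
  by (simp add: measure_pmf.emeasure_space_1)

context group
begin

lemma nn_integral_shift:
  assumes g: "g \<in> carrier G"
  shows "(\<integral>\<^sup>+x. h (x \<otimes> inv g) \<partial>count_space (carrier G)) = (\<integral>\<^sup>+x. h x \<partial>count_space (carrier G))"
proof (rule nn_integral_bij_count_space)
  show "bij_betw (\<lambda>x. x \<otimes> inv g) (carrier G) (carrier G)"
    by (rule bij_betwI[where g = "\<lambda>x. x \<otimes> g"]) (use g in \<open>auto simp: m_assoc\<close>)
qed

lemma nn_integral_inv:
  "(\<integral>\<^sup>+x. h (inv x) \<partial>count_space (carrier G)) = (\<integral>\<^sup>+x. h x \<partial>count_space (carrier G))"
proof (rule nn_integral_bij_count_space)
  show "bij_betw (\<lambda>x. inv x) (carrier G) (carrier G)"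
    by (rule bij_betwI[where g = "\<lambda>x. inv x"]) auto
qed

text \<open>The lazy step replaces \<open>f(x)\<close> by the mean over \<open>g\<close> of \<open>(f(x) + f(x inv g)) / 2\<close>. Jensen's inequality
  bounds the square of the mean, and by the parallelogram law the square of each midpoint falls
  short of the mean of the squares by a quarter of the squared difference.\<close>

lemma square_lazy_step:
  assumes p: "set_pmf p \<subseteq> carrier G" and x: "x \<in> carrier G"
  defines "F \<equiv> \<lambda>n. pmf (walk_pmf G (lazy_pmf G p) n)"
  shows "ennreal ((F (Suc n) x)\<^sup>2) + (\<integral>\<^sup>+g. ennreal (1/4 * (F n x - F n (x \<otimes> inv g))\<^sup>2) \<partial>p)
    \<le> (\<integral>\<^sup>+g. ennreal (1/2 * (F n x)\<^sup>2 + 1/2 * (F n (x \<otimes> inv g))\<^sup>2) \<partial>p)"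
proof -
  have F0: "0 \<le> F n y" for n y by (simp add: F_def)
  have parallelogram: "((a + b) / 2)\<^sup>2 + 1/4 * (a - b)\<^sup>2 = 1/2 * a\<^sup>2 + 1/2 * b\<^sup>2" for a b :: real
    by (simp add: power2_eq_square field_simps)
  have half: "ennreal a * ennreal (1/2) + ennreal b * ennreal (1/2) = ennreal ((b + a) / 2)"
    if "0 \<le> a" "0 \<le> b" for a b
  proof -
    have "ennreal a * ennreal (1/2) + ennreal b * ennreal (1/2) = ennreal (a * (1/2) + b * (1/2))"
      using that by (subst (1 2) ennreal_mult[symmetric]) auto
    then show ?thesis by (simp add: add_divide_distrib add.commute)
  qed
  have "ennreal (F (Suc n) x) = (\<integral>\<^sup>+g. F n (x \<otimes> inv g) \<partial>p) * ennreal (1/2) + ennreal (F n x) * ennreal (1/2)"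
    unfolding F_def pmf_walk_Suc[OF set_lazy_pmf[OF p] x]
    unfolding lazy_pmf_def nn_integral_bind_pmf using x
    by (subst nn_integral_bernoulli_pmf) auto
  also have "\<dots> = (\<integral>\<^sup>+g. ennreal (F n (x \<otimes> inv g)) * ennreal (1/2) + ennreal (F n x) * ennreal (1/2) \<partial>p)"
    by (subst nn_integral_add) (auto simp: nn_integral_multc measure_pmf.emeasure_space_1)
  also have "\<dots> = (\<integral>\<^sup>+g. ennreal ((F n x + F n (x \<otimes> inv g)) / 2) \<partial>p)"
    unfolding half[OF F0 F0] ..
  finally have "ennreal ((F (Suc n) x)\<^sup>2) = (\<integral>\<^sup>+g. ennreal ((F n x + F n (x \<otimes> inv g)) / 2) \<partial>p)\<^sup>2"
    by (simp add: F0 ennreal_power[symmetric])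
  also have "\<dots> \<le> (\<integral>\<^sup>+g. (ennreal ((F n x + F n (x \<otimes> inv g)) / 2))\<^sup>2 \<partial>p)"
    by (rule square_nn_integral_pmf_le)
  also have "\<dots> = (\<integral>\<^sup>+g. ennreal (((F n x + F n (x \<otimes> inv g)) / 2)\<^sup>2) \<partial>p)"
    by (simp add: F0 ennreal_power)
  finally have "ennreal ((F (Suc n) x)\<^sup>2) + (\<integral>\<^sup>+g. ennreal (1/4 * (F n x - F n (x \<otimes> inv g))\<^sup>2) \<partial>p)
    \<le> (\<integral>\<^sup>+g. ennreal (((F n x + F n (x \<otimes> inv g)) / 2)\<^sup>2) + ennreal (1/4 * (F n x - F n (x \<otimes> inv g))\<^sup>2) \<partial>p)"
    by (simp add: nn_integral_add add_right_mono)
  also have "\<dots> = (\<integral>\<^sup>+g. ennreal (1/2 * (F n x)\<^sup>2 + 1/2 * (F n (x \<otimes> inv g))\<^sup>2) \<partial>p)"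
    by (intro nn_integral_cong, subst ennreal_plus[symmetric]) (simp, simp, simp only: parallelogram)
  finally show ?thesis .
qed

text \<open>Summing the pointwise estimate over \<open>x\<close>: translation invariance of the counting measure
  turns the right-hand side into the old square sum, and a single increment \<open>g\<close> is kept from the
  mean of the differences.\<close>

lemma square_sum_lazy_step:
  assumes p: "set_pmf p \<subseteq> carrier G" and C: "countable (carrier G)" and g: "g \<in> carrier G"
  defines "F \<equiv> \<lambda>n. pmf (walk_pmf G (lazy_pmf G p) n)"
  shows "square_sum G (F (Suc n)) + ennreal (pmf p g / 4) * shift_diff G (F n) g \<le> square_sum G (F n)"
proof -
  let ?C = "count_space (carrier G)"
  have half: "ennreal (1/2) + ennreal (1/2) = 1"
    by (subst ennreal_plus[symmetric]) auto
  let ?E = "\<lambda>g. \<integral>\<^sup>+x. ennreal (1/4 * (F n x - F n (x \<otimes> inv g))\<^sup>2) \<partial>?C"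
  have E: "?E h = ennreal (1/4) * shift_diff G (F n) h" for h
    unfolding shift_diff_def by (subst nn_integral_cmult[symmetric]) (auto simp: ennreal_mult[symmetric])
  have "ennreal (pmf p g / 4) * shift_diff G (F n) g = ennreal (pmf p g) * ?E g"
    unfolding E by (simp add: mult.assoc[symmetric] ennreal_mult[symmetric])
  also have "\<dots> = (\<integral>\<^sup>+h. ?E g * indicator {g} h \<partial>p)"
    by (subst nn_integral_cmult_indicator) (auto simp only: emeasure_pmf_single mult.commute sets_measure_pmf UNIV_I)
  also have "\<dots> \<le> (\<integral>\<^sup>+h. ?E h \<partial>p)"
    by (intro nn_integral_mono) (auto simp: indicator_def)
  also have "\<dots> = (\<integral>\<^sup>+x. \<integral>\<^sup>+h. ennreal (1/4 * (F n x - F n (x \<otimes> inv h))\<^sup>2) \<partial>p \<partial>?C)"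
    by (rule nn_integral_count_space_nn_integral) (auto simp: C)
  finally have "square_sum G (F (Suc n)) + ennreal (pmf p g / 4) * shift_diff G (F n) g
    \<le> (\<integral>\<^sup>+x. ennreal ((F (Suc n) x)\<^sup>2) + (\<integral>\<^sup>+h. ennreal (1/4 * (F n x - F n (x \<otimes> inv h))\<^sup>2) \<partial>p) \<partial>?C)"
    by (simp add: nn_integral_add square_sum_def add_left_mono)
  also have "\<dots> \<le> (\<integral>\<^sup>+x. \<integral>\<^sup>+h. ennreal (1/2 * (F n x)\<^sup>2 + 1/2 * (F n (x \<otimes> inv h))\<^sup>2) \<partial>p \<partial>?C)"
    using square_lazy_step[OF p, folded F_def] by (intro nn_integral_mono) (auto simp: F_def)
  also have "\<dots> = (\<integral>\<^sup>+h. \<integral>\<^sup>+x. ennreal (1/2 * (F n x)\<^sup>2 + 1/2 * (F n (x \<otimes> inv h))\<^sup>2) \<partial>?C \<partial>p)"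
    by (rule nn_integral_count_space_nn_integral[symmetric]) (auto simp: C)
  also have "\<dots> = (\<integral>\<^sup>+h. square_sum G (F n) \<partial>p)"
  proof (intro nn_integral_cong_AE AE_pmfI)
    fix h assume "h \<in> set_pmf p"
    with p have h: "h \<in> carrier G" by auto
    have "(\<integral>\<^sup>+x. ennreal (1/2 * (F n x)\<^sup>2 + 1/2 * (F n (x \<otimes> inv h))\<^sup>2) \<partial>?C)
      = (\<integral>\<^sup>+x. ennreal (1/2) * ennreal ((F n x)\<^sup>2) + ennreal (1/2) * ennreal ((F n (x \<otimes> inv h))\<^sup>2) \<partial>?C)"
      by (intro nn_integral_cong, subst ennreal_plus) (auto simp only: ennreal_mult'' zero_le_power2 zero_le_mult_iff zero_le_divide_1_iff zero_le_numeral)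
    also have "\<dots> = ennreal (1/2) * square_sum G (F n) + ennreal (1/2) * square_sum G (F n)"
      using nn_integral_shift[OF h, of "\<lambda>x. ennreal ((F n x)\<^sup>2)"]
      by (subst nn_integral_add) (auto simp: nn_integral_cmult square_sum_def)
    also have "\<dots> = square_sum G (F n)"
      by (simp only: distrib_right[symmetric] half mult_1)
    finally show "(\<integral>\<^sup>+x. ennreal (1/2 * (F n x)\<^sup>2 + 1/2 * (F n (x \<otimes> inv h))\<^sup>2) \<partial>?C) = square_sum G (F n)" .
  qed
  also have "\<dots> = square_sum G (F n)"
    by (simp add: measure_pmf.emeasure_space_1)
  finally show ?thesis .
qed

text \<open>The triangle inequality for the \<open>\<ell>\<^sup>2\<close> distance between \<open>f\<close> and its translates, in the squared form
  \<open>(a + b)\<^sup>2 \<le> (1 + 1/t) a\<^sup>2 + (1 + t) b\<^sup>2\<close>; the free parameter is tuned to word length below.\<close>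

lemma shift_diff_mult_le:
  assumes y: "y \<in> carrier G" and s: "s \<in> carrier G" and t: "t > 0"
  shows "shift_diff G f (y \<otimes> s) \<le> ennreal (1 + 1 / t) * shift_diff G f y + ennreal (1 + t) * shift_diff G f s"
proof -
  let ?C = "count_space (carrier G)"
  have young: "(a + b)\<^sup>2 \<le> (1 + 1 / t) * a\<^sup>2 + (1 + t) * b\<^sup>2" for a b :: real
  proof -
    have "0 \<le> (a / sqrt t - sqrt t * b)\<^sup>2" by simp
    also have "\<dots> = a\<^sup>2 / t - 2 * a * b + t * b\<^sup>2"
      using t by (simp add: power2_diff power_divide power_mult_distrib)
    finally show ?thesis by (simp add: power2_sum field_simps)
  qed
  have "shift_diff G f (y \<otimes> s) \<le> (\<integral>\<^sup>+x. ennreal (1 + 1 / t) * ennreal ((f (x \<otimes> inv s) - f (x \<otimes> inv s \<otimes> inv y))\<^sup>2)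
      + ennreal (1 + t) * ennreal ((f x - f (x \<otimes> inv s))\<^sup>2) \<partial>?C)"
    unfolding shift_diff_def
  proof (intro nn_integral_mono)
    fix x assume "x \<in> space ?C"
    then have x: "x \<in> carrier G" by simp
    have eq: "x \<otimes> inv (y \<otimes> s) = x \<otimes> inv s \<otimes> inv y"
      using x y s by (simp add: inv_mult_group m_assoc)
    show "ennreal ((f x - f (x \<otimes> inv (y \<otimes> s)))\<^sup>2) \<le> ennreal (1 + 1 / t) * ennreal ((f (x \<otimes> inv s) - f (x \<otimes> inv s \<otimes> inv y))\<^sup>2)
      + ennreal (1 + t) * ennreal ((f x - f (x \<otimes> inv s))\<^sup>2)"
      unfolding eq using t young[of "f (x \<otimes> inv s) - f (x \<otimes> inv s \<otimes> inv y)" "f x - f (x \<otimes> inv s)"]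
      by (simp add: ennreal_mult[symmetric] ennreal_plus[symmetric] del: ennreal_plus)
  qed
  also have "\<dots> = ennreal (1 + 1 / t) * shift_diff G f y + ennreal (1 + t) * shift_diff G f s"
    using nn_integral_shift[OF s, of "\<lambda>x. ennreal ((f x - f (x \<otimes> inv y))\<^sup>2)"]
    by (subst nn_integral_add) (auto simp: nn_integral_cmult shift_diff_def)
  finally show ?thesis .
qed

text \<open>With \<open>t = r\<close> at the step from \<open>r\<close> to \<open>r + 1\<close> factors the weights add up exactly:
  \<open>(1 + 1/r) r\<^sup>2 + (1 + r) = (r + 1)\<^sup>2\<close>.\<close>

lemma shift_diff_set_power:
  assumes T: "T \<subseteq> carrier G" and D: "\<And>g. g \<in> T \<Longrightarrow> shift_diff G f g \<le> ennreal D" "D \<ge> 0"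
    and y: "y \<in> set_power G T r"
  shows "shift_diff G f y \<le> ennreal ((real r)\<^sup>2 * D)"
  using y
proof (induction r arbitrary: y)
  case 0
  then have "shift_diff G f y = (\<integral>\<^sup>+x. 0 \<partial>count_space (carrier G))"
    unfolding shift_diff_def by (intro nn_integral_cong) auto
  then show ?case by simp
next
  case (Suc r)
  then obtain z s where z: "z \<in> set_power G T r" and s: "s \<in> T" and y: "y = z \<otimes> s"
    by (auto simp: set_mult_def)
  have zs: "z \<in> carrier G" "s \<in> carrier G" using z s T set_power_subset[OF T] by auto
  show ?case
  proof (cases "r = 0")
    case True
    with z y zs D(1)[OF s] show ?thesis by simp
  next
    case False
    then have "shift_diff G f y \<le> ennreal (1 + 1 / real r) * shift_diff G f z + ennreal (1 + real r) * shift_diff G f s"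
      unfolding y by (intro shift_diff_mult_le zs) auto
    also have "\<dots> \<le> ennreal (1 + 1 / real r) * ennreal ((real r)\<^sup>2 * D) + ennreal (1 + real r) * ennreal D"
      by (intro add_mono mult_left_mono Suc.IH z D s) auto
    also have "\<dots> = ennreal ((1 + 1 / real r) * ((real r)\<^sup>2 * D) + (1 + real r) * D)"
      using D(2) by (simp add: ennreal_mult[symmetric] ennreal_plus[symmetric] del: ennreal_plus)
    also have "(1 + 1 / real r) * ((real r)\<^sup>2 * D) + (1 + real r) * D = (real (Suc r))\<^sup>2 * D"
      using False by (simp add: power2_eq_square field_simps)
    finally show ?thesis .
  qed
qed

text \<open>By polarisation, \<open>2 \<Sum>x. f(x)\<^sup>2\<close> is the squared difference under translation by \<open>y\<close> plus twice
  the correlation \<open>\<Sum>x. f(x) f(x inv y)\<close>. The points \<open>x inv y\<close> for \<open>y\<close> in \<open>Y\<close> are distinct, so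
  the correlations add up to at most \<open>1\<close>: averaging over \<open>Y\<close> makes them small.\<close>

lemma square_sum_le_shift_diff:
  assumes q: "set_pmf q \<subseteq> carrier G" and Y: "finite Y" "Y \<subseteq> carrier G"
    and E: "\<And>y. y \<in> Y \<Longrightarrow> shift_diff G (pmf q) y \<le> E"
  shows "2 * of_nat (card Y) * square_sum G (pmf q) \<le> of_nat (card Y) * E + 2"
proof -
  let ?C = "count_space (carrier G)" and ?F = "pmf q"
  let ?I = "\<lambda>y. \<integral>\<^sup>+x. ennreal (?F x * ?F (x \<otimes> inv y)) \<partial>?C"
  have square: "a\<^sup>2 + b\<^sup>2 = (a - b)\<^sup>2 + 2 * (a * b)" for a b :: real
    by (simp add: power2_eq_square algebra_simps)
  have polar: "2 * square_sum G ?F = shift_diff G ?F y + 2 * ?I y" if y: "y \<in> carrier G" for y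
  proof -
    have "2 * square_sum G ?F = (\<integral>\<^sup>+x. ennreal ((?F x)\<^sup>2) + ennreal ((?F (x \<otimes> inv y))\<^sup>2) \<partial>?C)"
      using nn_integral_shift[OF y, of "\<lambda>x. ennreal ((?F x)\<^sup>2)"]
      unfolding mult_2 square_sum_def by (subst nn_integral_add) simp_all
    also have "\<dots> = (\<integral>\<^sup>+x. ennreal ((?F x - ?F (x \<otimes> inv y))\<^sup>2) + 2 * ennreal (?F x * ?F (x \<otimes> inv y)) \<partial>?C)"
      unfolding two_times_ennreal
      by (intro nn_integral_cong, subst (1 2) ennreal_plus[symmetric]) (simp_all add: square)
    also have "\<dots> = shift_diff G ?F y + 2 * ?I y"
      by (subst nn_integral_add) (auto simp: nn_integral_cmult shift_diff_def)
    finally show ?thesis .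
  qed
  have le1: "(\<Sum>y\<in>Y. ?F (x \<otimes> inv y)) \<le> 1" if x: "x \<in> carrier G" for x
  proof -
    have "inj_on (\<lambda>y. x \<otimes> inv y) Y"
      using x Y(2) by (auto intro!: inj_onI simp: subset_iff)
    then have "(\<Sum>y\<in>Y. ?F (x \<otimes> inv y)) = sum ?F ((\<lambda>y. x \<otimes> inv y) ` Y)"
      by (simp add: sum.reindex)
    also have "\<dots> = measure q ((\<lambda>y. x \<otimes> inv y) ` Y)"
      by (rule measure_measure_pmf_finite[symmetric]) (use Y in auto)
    finally show ?thesis by simp
  qed
  have "(\<Sum>y\<in>Y. ?I y) = (\<integral>\<^sup>+x. (\<Sum>y\<in>Y. ennreal (?F x * ?F (x \<otimes> inv y))) \<partial>?C)"
    by (rule nn_integral_sum[symmetric]) auto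
  also have "\<dots> = (\<integral>\<^sup>+x. ennreal (?F x * (\<Sum>y\<in>Y. ?F (x \<otimes> inv y))) \<partial>?C)"
    by (intro nn_integral_cong) (simp add: sum_distrib_left)
  also have "\<dots> \<le> (\<integral>\<^sup>+x. ennreal (?F x) \<partial>?C)"
    by (intro nn_integral_mono ennreal_leI) (auto intro!: mult_left_le le1)
  also have "\<dots> \<le> 1"
    by (simp add: nn_integral_pmf measure_pmf.emeasure_eq_measure)
  finally have cross: "(\<Sum>y\<in>Y. ?I y) \<le> 1" .
  have "2 * of_nat (card Y) * square_sum G ?F = (\<Sum>y\<in>Y. 2 * square_sum G ?F)"
    by (simp add: mult_ac)
  also have "\<dots> = (\<Sum>y\<in>Y. shift_diff G ?F y) + 2 * (\<Sum>y\<in>Y. ?I y)"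
    using Y(2) by (subst sum_distrib_left, subst sum.distrib[symmetric]) (intro sum.cong polar, auto)
  also have "\<dots> \<le> (\<Sum>y\<in>Y. E) + 2 * 1"
    by (intro add_mono sum_mono E mult_left_mono cross) auto
  finally show ?thesis by simp
qed

text \<open>To return at time \<open>n + k\<close> the walk must be at some \<open>y\<close> at time \<open>n\<close> and then travel back by
  \<open>inv y\<close> in \<open>k\<close> steps; the product of the two probabilities is bounded by the mean of their
  squares. This converts bounds on square sums into bounds on return probabilities.\<close>

lemma pmf_walk_one_le:
  assumes p: "set_pmf p \<subseteq> carrier G"
  defines "F \<equiv> \<lambda>n. pmf (walk_pmf G p n)"
  shows "2 * ennreal (F (n + k) \<one>) \<le> square_sum G (F n) + square_sum G (F k)"
proof -
  let ?C = "count_space (carrier G)"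
  have "ennreal (F (n + k) \<one>) = (\<integral>\<^sup>+y. ennreal (F n y) * ennreal (F k (inv y \<otimes> \<one>)) \<partial>?C)"
    unfolding F_def by (simp add: pmf_walk_add[OF p] nn_integral_pmf_on[OF set_walk_pmf[OF p]])
  also have "\<dots> = (\<integral>\<^sup>+y. ennreal (F n y * F k (inv y)) \<partial>?C)"
    by (intro nn_integral_cong) (auto simp: ennreal_mult F_def)
  finally have "2 * ennreal (F (n + k) \<one>) = (\<integral>\<^sup>+y. 2 * ennreal (F n y * F k (inv y)) \<partial>?C)"
    by (subst nn_integral_cmult) simp_all
  also have "\<dots> \<le> (\<integral>\<^sup>+y. ennreal ((F n y)\<^sup>2) + ennreal ((F k (inv y))\<^sup>2) \<partial>?C)"
  proof (intro nn_integral_mono)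
    fix y
    have "2 * (F n y * F k (inv y)) \<le> (F n y)\<^sup>2 + (F k (inv y))\<^sup>2"
      using sum_squares_bound[of "F n y" "F k (inv y)"] by simp
    then have "2 * ennreal (F n y * F k (inv y)) \<le> ennreal ((F n y)\<^sup>2 + (F k (inv y))\<^sup>2)"
      unfolding two_times_ennreal by (rule ennreal_leI)
    also have "\<dots> = ennreal ((F n y)\<^sup>2) + ennreal ((F k (inv y))\<^sup>2)"
      by (rule ennreal_plus) auto
    finally show "2 * ennreal (F n y * F k (inv y)) \<le> ennreal ((F n y)\<^sup>2) + ennreal ((F k (inv y))\<^sup>2)" .
  qed
  also have "\<dots> = square_sum G (F n) + square_sum G (F k)"
    using nn_integral_inv[of "\<lambda>x. ennreal ((F k x)\<^sup>2)"]
    by (subst nn_integral_add) (auto simp: square_sum_def)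
  finally show ?thesis .
qed

end

section \<open>Uniform tails of the return probabilities\<close>

text \<open>The factor in front of the telescoping difference that results from the Nash inequality with
  coefficients \<open>A\<close> and \<open>B\<close> when the radius is chosen as in the next proof.\<close>

definition nash_const :: "real \<Rightarrow> real \<Rightarrow> real" where
  "nash_const A B = 6 * A * (root 3 (2 * B) + 1)\<^sup>2"

text \<open>Written in terms of the cube roots \<open>a\<close> and \<open>b\<close> of two consecutive square sums. The radius is the
  least integer for which the term \<open>B / r\<^sup>3\<close> is at most half of the left-hand side; it has order
  \<open>1 / a\<close>, and this loss of \<open>1 / a\<^sup>2\<close> is compensated by
  \<open>a\<^sup>3 - b\<^sup>3 \<le> 3 a\<^sup>2 (a - b)\<close>.\<close>

lemma nash_recursion_step:
  fixes a b A B :: real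
  assumes ab: "0 \<le> b" "b \<le> a" "a \<le> 1" and A: "A > 0" and B: "B > 0"
    and nash: "\<And>r::nat. r \<ge> 1 \<Longrightarrow> a ^ 3 \<le> A * (real r)\<^sup>2 * (a ^ 3 - b ^ 3) + B / real r ^ 3"
  shows "a ^ 3 \<le> nash_const A B * (a - b)"
proof (cases "a = 0")
  case True
  with ab show ?thesis by simp
next
  case False
  with ab have a: "a > 0" by simp
  define K where "K = root 3 (2 * B)"
  have K: "K > 0" "K ^ 3 = 2 * B" using B by (auto simp: K_def)
  define r where "r = nat \<lceil>K / a\<rceil>"
  have Ka: "K / a > 0" using K a by simp
  have r1: "r \<ge> 1" unfolding r_def using Ka by linarith
  have r_lower: "K / a \<le> real r" unfolding r_def by linarith
  have "real r \<le> K / a + 1" unfolding r_def using Ka by linarith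
  also have "\<dots> \<le> (K + 1) / a" using a ab by (simp add: field_simps)
  finally have r_upper: "real r \<le> (K + 1) / a" .
  have "(K / a) ^ 3 \<le> real r ^ 3" using r_lower Ka by (intro power_mono) auto
  then have "B / real r ^ 3 \<le> B / (K / a) ^ 3"
    using B Ka by (intro divide_left_mono) auto
  also have "\<dots> = a ^ 3 / 2" using K(1) B a by (simp add: power_divide K(2))
  finally have small: "B / real r ^ 3 \<le> a ^ 3 / 2" .
  have cubes: "a ^ 3 - b ^ 3 \<le> 3 * a\<^sup>2 * (a - b)"
  proof -
    have "a ^ 3 - b ^ 3 = (a\<^sup>2 + a * b + b\<^sup>2) * (a - b)"
      by (simp add: power2_eq_square power3_eq_cube algebra_simps)
    moreover have "a\<^sup>2 + a * b + b\<^sup>2 \<le> 3 * a\<^sup>2"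
    proof -
      have "a * b \<le> a * a" "b * b \<le> a * a"
        using ab by (auto intro: mult_left_mono mult_mono)
      then show ?thesis by (simp add: power2_eq_square)
    qed
    ultimately show ?thesis using ab by (auto intro!: mult_right_mono)
  qed
  have "(real r)\<^sup>2 \<le> ((K + 1) / a)\<^sup>2" using r_upper by (intro power_mono) auto
  moreover have "0 \<le> a ^ 3 - b ^ 3" using ab by (simp add: power_mono)
  ultimately have "A * (real r)\<^sup>2 * (a ^ 3 - b ^ 3) \<le> A * ((K + 1) / a)\<^sup>2 * (3 * a\<^sup>2 * (a - b))"
    using A cubes by (intro mult_mono) auto
  also have "\<dots> = 3 * A * (K + 1)\<^sup>2 * (a - b)"
    using a by (simp add: power_divide)
  finally have "a ^ 3 \<le> 3 * A * (K + 1)\<^sup>2 * (a - b) + a ^ 3 / 2"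
    using nash[OF r1] small by linarith
  then show ?thesis by (simp add: nash_const_def K_def)
qed

text \<open>The differences of the cube roots telescope, which bounds the tail from \<open>J\<close> on by a multiple of
  the cube root of \<open>u J\<close>. The same bound for the whole sum, combined with monotonicity of \<open>u\<close>,
  shows that \<open>u J\<close> is of order \<open>1 / (J + 1)\<close>, so the tails vanish at an explicit rate.\<close>

lemma nash_recursion_sum:
  fixes u :: "nat \<Rightarrow> real"
  assumes u: "\<And>n. 0 \<le> u n" "\<And>n. u n \<le> 1" "decseq u" and A: "A > 0" and B: "B > 0"
    and nash: "\<And>n r. r \<ge> 1 \<Longrightarrow> u n \<le> A * (real r)\<^sup>2 * (u n - u (Suc n)) + B / real r ^ 3"
  shows "(\<Sum>j\<in>{J..<M}. u j) \<le> nash_const A B * root 3 (nash_const A B / real (Suc J))"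
proof -
  let ?L = "nash_const A B"
  define a where "a n = root 3 (u n)" for n
  have a3: "a n ^ 3 = u n" for n using u(1) by (simp add: a_def)
  have a: "0 \<le> a n" "a (Suc n) \<le> a n" "a n \<le> 1" for n
    using u(1,2) decseq_SucD[OF u(3)] by (auto simp: a_def)
  have L: "?L > 0"
  proof -
    have "root 3 (2 * B) > 0" using B by simp
    with A show ?thesis
      unfolding nash_const_def by (intro mult_pos_pos zero_less_power add_pos_pos) auto
  qed
  have step: "u n \<le> ?L * (a n - a (Suc n))" for n
    using nash_recursion_step[of "a (Suc n)" "a n" A B] a A B nash[of _ n] by (simp add: a3)
  have telescope: "(\<Sum>j\<in>{J..<M}. u j) \<le> ?L * a J" for J M
  proof (cases "J \<le> M")
    case True
    have "(\<Sum>j\<in>{J..<M}. u j) \<le> (\<Sum>j\<in>{J..<M}. ?L * (a j - a (Suc j)))"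
      by (intro sum_mono step)
    also have "\<dots> = ?L * (a J - a M)"
      using sum_Suc_diff'[OF True, of "\<lambda>n. - a n"] by (simp add: sum_distrib_left[symmetric])
    also have "\<dots> \<le> ?L * a J" using a(1)[of M] L by (simp add: algebra_simps)
    finally show ?thesis .
  next
    case False
    then show ?thesis using L a(1)[of J] by simp
  qed
  have "real (Suc J) * u J = (\<Sum>j\<in>{0..<Suc J}. u J)" by simp
  also have "\<dots> \<le> (\<Sum>j\<in>{0..<Suc J}. u j)"
    using u(3) by (intro sum_mono) (auto simp: decseq_def)
  also have "\<dots> \<le> ?L * a 0" by (rule telescope)
  also have "\<dots> \<le> ?L" using a(3)[of 0] L by simp
  finally have "u J \<le> ?L / real (Suc J)" by (simp add: field_simps)
  then have "a J \<le> root 3 (?L / real (Suc J))" unfolding a_def by simp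
  then have "?L * a J \<le> ?L * root 3 (?L / real (Suc J))" using L by simp
  with telescope[of J M] show ?thesis by linarith
qed

lemma sum_binomial_half_powers: "(\<Sum>n\<in>{m..2 * m}. real (n choose m) / 2 ^ n) = 1"
proof -
  have "(\<Sum>n\<in>{m..2 * m}. real (n choose m) / 2 ^ n) = (\<Sum>k\<le>m. real ((m + k) choose m) / 2 ^ (m + k))"
    by (rule sum.reindex_bij_witness[of _ "\<lambda>k. m + k" "\<lambda>n. n - m"]) auto
  also have "\<dots> = (\<Sum>k\<le>m. (real (m + k) gchoose k) / 2 ^ k) / 2 ^ m"
    by (simp add: sum_divide_distrib power_add mult.commute binomial_gbinomial[symmetric]
        of_nat_add[symmetric] binomial_symmetric[of m] del: of_nat_add)
  also have "\<dots> = 1" by (simp only: gbinomial_sum_nat_pow2) simp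
  finally show ?thesis .
qed

text \<open>The weights with which \<open>q m\<close> occurs in the averages at times \<open>m, \<dots>, 2 m\<close> already add up to
  \<open>1\<close>, so every term on the left is accounted for on the right.\<close>

lemma sum_le_sum_binomial_average:
  fixes q :: "nat \<Rightarrow> real"
  assumes q: "\<And>m. 0 \<le> q m"
  shows "(\<Sum>m\<in>{N..<M}. q m) \<le> (\<Sum>n\<in>{N..<2 * M}. \<Sum>m\<le>n. (n choose m) / 2 ^ n * q m)"
proof -
  have "(\<Sum>m\<in>{N..<M}. q m) = (\<Sum>m\<in>{N..<M}. \<Sum>n\<in>{m..2 * m}. (n choose m) / 2 ^ n * q m)"
    by (simp only: sum_distrib_right[symmetric] sum_binomial_half_powers mult_1)
  also have "\<dots> \<le> (\<Sum>m\<in>{N..<M}. \<Sum>n\<in>{N..<2 * M}. (n choose m) / 2 ^ n * q m)"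
    using q by (intro sum_mono sum_mono2) auto
  also have "\<dots> = (\<Sum>n\<in>{N..<2 * M}. \<Sum>m\<in>{N..<M}. (n choose m) / 2 ^ n * q m)"
    by (rule sum.swap)
  also have "\<dots> \<le> (\<Sum>n\<in>{N..<2 * M}. \<Sum>m\<le>n. (n choose m) / 2 ^ n * q m)"
  proof (intro sum_mono)
    fix n
    have "(\<Sum>m\<in>{N..<M}. (n choose m) / 2 ^ n * q m) = (\<Sum>m\<in>{N..<M} \<inter> {..n}. (n choose m) / 2 ^ n * q m)"
      by (rule sum.mono_neutral_right) auto
    also have "\<dots> \<le> (\<Sum>m\<le>n. (n choose m) / 2 ^ n * q m)"
      using q by (intro sum_mono2) auto
    finally show "(\<Sum>m\<in>{N..<M}. (n choose m) / 2 ^ n * q m) \<le> (\<Sum>m\<le>n. (n choose m) / 2 ^ n * q m)" .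
  qed
  finally show ?thesis .
qed

lemma sum_div_two_le:
  fixes u :: "nat \<Rightarrow> real"
  assumes u: "\<And>n. 0 \<le> u n"
  shows "(\<Sum>n\<in>{N..<2 * M}. u (n div 2)) \<le> 2 * (\<Sum>j\<in>{N div 2..<M}. u j)"
proof -
  have "(\<Sum>n\<in>{N..<2 * M}. u (n div 2)) \<le> (\<Sum>n\<in>{2 * (N div 2)..<2 * M}. u (n div 2))"
    using u by (intro sum_mono2) auto
  also have "\<dots> = 2 * (\<Sum>j\<in>{N div 2..<M}. u j)"
    by (induction M) (auto simp: not_le le_Suc_eq)
  finally show ?thesis .
qed

context group
begin

lemma square_sum_pmf_le_1: "square_sum G (pmf q) \<le> 1"
proof -
  have "square_sum G (pmf q) \<le> (\<integral>\<^sup>+x. ennreal (pmf q x) \<partial>count_space (carrier G))"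
    unfolding square_sum_def power2_eq_square
    by (intro nn_integral_mono ennreal_leI) (auto intro!: mult_left_le simp: pmf_le_1)
  also have "\<dots> \<le> 1"
    by (simp add: nn_integral_pmf measure_pmf.emeasure_eq_measure)
  finally show ?thesis .
qed

text \<open>The uniform tail estimate. The right-hand side depends on the law \<open>p\<close> only through the lower
  bound \<open>a\<close> for the masses on \<open>T\<close>. The identity is exempt from that bound because translating by it
  changes nothing; it may belong to \<open>T\<close> to make word lengths comparable.\<close>

lemma sum_return_prob_le:
  assumes C: "countable (carrier G)" and p: "set_pmf p \<subseteq> carrier G"
    and T: "T \<subseteq> carrier G" "\<And>g. g \<in> T \<Longrightarrow> g = \<one> \<or> a \<le> pmf p g" and a: "a > 0"
    and Y: "\<And>r. r \<ge> 1 \<Longrightarrow> finite (Y r)" "\<And>r. r \<ge> 1 \<Longrightarrow> Y r \<subseteq> set_power G T (K * r)"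
    and card: "\<And>r. r \<ge> 1 \<Longrightarrow> c * real r ^ 3 \<le> real (card (Y r))" and c: "c > 0" and K: "K > 0"
  defines "L \<equiv> nash_const (2 * (real K)\<^sup>2 / a) (1 / c)"
  shows "(\<Sum>m\<in>{N..<M}. pmf (walk_pmf G p m) \<one>) \<le> 2 * L * root 3 (L / real (Suc (N div 2)))"
proof -
  define F where "F n = pmf (walk_pmf G (lazy_pmf G p) n)" for n
  define u where "u n = enn2real (square_sum G (F n))" for n
  note lazy = set_walk_pmf[OF set_lazy_pmf[OF p]]
  have u: "square_sum G (F n) = ennreal (u n)" for n
    using square_sum_pmf_le_1[of "walk_pmf G (lazy_pmf G p) n"] unfolding u_def F_def
    by (subst ennreal_enn2real) (auto simp: order_le_less_trans less_top[symmetric] top_unique)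
  have u0: "0 \<le> u n" for n by (simp add: u_def)
  have u1: "u n \<le> 1" for n
    using square_sum_pmf_le_1[of "walk_pmf G (lazy_pmf G p) n"] u[of n] by (simp add: F_def)
  have energy: "ennreal (u (Suc n)) + ennreal (pmf p g / 4) * shift_diff G (F n) g \<le> ennreal (u n)"
    if "g \<in> carrier G" for n g
    using square_sum_lazy_step[OF p C that, of n] unfolding F_def[symmetric] u .
  have dec: "u (Suc n) \<le> u n" for n
  proof -
    have "ennreal (u (Suc n)) \<le> ennreal (u n)"
      using energy[OF one_closed, of n] by (rule order_trans[rotated]) simp
    then show ?thesis using u0 by simp
  qed
  have shift_one: "shift_diff G f \<one> = 0" for f
  proof -
    have "shift_diff G f \<one> = (\<integral>\<^sup>+x. 0 \<partial>count_space (carrier G))"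
      unfolding shift_diff_def by (intro nn_integral_cong) auto
    then show ?thesis by simp
  qed
  \<comment> \<open>The energy lost in one step controls each generator's translation difference.\<close>
  have D: "shift_diff G (F n) g \<le> ennreal (4 / a * (u n - u (Suc n)))" if g: "g \<in> T" for g n
  proof (cases "g = \<one>")
    case True
    then show ?thesis by (simp add: shift_one)
  next
    case False
    with T g have ag: "a \<le> pmf p g" "g \<in> carrier G" by auto
    let ?s = "shift_diff G (F n) g"
    have le: "ennreal (u (Suc n)) + ennreal (a / 4) * ?s \<le> ennreal (u n)"
      using energy[OF ag(2), of n] ag(1)
      by (elim order_trans[rotated]) (auto intro!: add_left_mono mult_right_mono ennreal_leI)
    have "?s \<noteq> \<top>"
    proof
      assume "?s = \<top>"
      with le a show False by (simp add: ennreal_mult_top top_unique)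
    qed
    then obtain s where s: "?s = ennreal s" "s \<ge> 0" by (cases ?s) auto
    have "ennreal (a / 4) * ennreal s = ennreal (a / 4 * s)"
      using a s by (intro ennreal_mult[symmetric]) auto
    with le a s u0 have "ennreal (u (Suc n) + a / 4 * s) \<le> ennreal (u n)"
      by simp
    then have "u (Suc n) + a / 4 * s \<le> u n"
      using u0 by simp
    then have "s \<le> 4 / a * (u n - u (Suc n))" using a by (simp add: field_simps)
    with s show ?thesis by (simp add: ennreal_leI)
  qed
  \<comment> \<open>Almost invariance under the set \<open>Y r\<close>, whose elements are words of length \<open>K * r\<close> over \<open>T\<close>.\<close>
  have nash: "u n \<le> 2 * (real K)\<^sup>2 / a * (real r)\<^sup>2 * (u n - u (Suc n)) + 1 / c / real r ^ 3"
    if r: "r \<ge> 1" for n r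
  proof -
    define E where "E = (real (K * r))\<^sup>2 * (4 / a * (u n - u (Suc n)))"
    have E0: "E \<ge> 0" using a dec by (simp add: E_def)
    have "shift_diff G (F n) y \<le> ennreal E" if "y \<in> Y r" for y
      unfolding E_def using that Y(2)[OF r] a dec
      by (intro shift_diff_set_power[OF T(1) D]) auto
    then have "2 * of_nat (card (Y r)) * square_sum G (F n) \<le> of_nat (card (Y r)) * ennreal E + 2"
      unfolding F_def using Y[OF r] set_power_subset[OF T(1)]
      by (intro square_sum_le_shift_diff lazy) auto
    then have "ennreal (2 * real (card (Y r)) * u n) \<le> ennreal (real (card (Y r)) * E + 2)"
      using E0 u0 by (simp add: u ennreal_of_nat_eq_real_of_nat ennreal_mult)
    then have le: "2 * real (card (Y r)) * u n \<le> real (card (Y r)) * E + 2"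
      using E0 by (subst (asm) ennreal_le_iff) auto
    have cr: "c * real r ^ 3 > 0" using c r by simp
    then have Yr: "real (card (Y r)) > 0" using card[OF r] by linarith
    have "u n \<le> E / 2 + 1 / real (card (Y r))" using le Yr by (simp add: field_simps)
    also have "1 / real (card (Y r)) \<le> 1 / (c * real r ^ 3)"
      using card[OF r] cr by (intro divide_left_mono) auto
    also have "E / 2 = 2 * (real K)\<^sup>2 / a * (real r)\<^sup>2 * (u n - u (Suc n))"
      using a by (simp add: E_def power_mult_distrib field_simps)
    finally show ?thesis by simp
  qed
  have A: "2 * (real K)\<^sup>2 / a > 0" using K a by simp
  have ret: "F n \<one> \<le> u (n div 2)" for n
  proof -
    have "2 * ennreal (F n \<one>) \<le> ennreal (u (n div 2)) + ennreal (u (n - n div 2))"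
      using pmf_walk_one_le[OF set_lazy_pmf[OF p], of "n div 2" "n - n div 2"]
      unfolding F_def[symmetric] u by simp
    then have "ennreal (2 * F n \<one>) \<le> ennreal (u (n div 2) + u (n - n div 2))"
      using u0 by (simp add: two_times_ennreal)
    then have "2 * F n \<one> \<le> u (n div 2) + u (n - n div 2)"
      using u0 by (subst (asm) ennreal_le_iff) auto
    also have "u (n - n div 2) \<le> u (n div 2)"
      using dec by (intro decseqD[of u]) (auto simp: decseq_Suc_iff)
    finally show ?thesis by simp
  qed
  have "(\<Sum>m\<in>{N..<M}. pmf (walk_pmf G p m) \<one>) \<le> (\<Sum>n\<in>{N..<2 * M}. F n \<one>)"
    using sum_le_sum_binomial_average[of "\<lambda>m. pmf (walk_pmf G p m) \<one>" N M]
    by (simp add: F_def pmf_walk_lazy[OF p])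
  also have "\<dots> \<le> (\<Sum>n\<in>{N..<2 * M}. u (n div 2))"
    by (intro sum_mono ret)
  also have "\<dots> \<le> 2 * (\<Sum>j\<in>{N div 2..<M}. u j)"
    by (rule sum_div_two_le[OF u0])
  also have "\<dots> \<le> 2 * (L * root 3 (L / real (Suc (N div 2))))"
    unfolding L_def using c A nash u0 u1 dec
    by (intro mult_left_mono nash_recursion_sum) (auto simp: decseq_Suc_iff)
  finally show ?thesis by (simp add: mult.assoc)
qed

end

section \<open>Continuity of the return probabilities\<close>

text \<open>Scheffe's lemma: no mass can escape, because the limit has total mass \<open>1\<close> as well.\<close>

lemma integral_pmf_diff_tendsto:
  fixes ps :: "nat \<Rightarrow> 'a pmf"
  assumes "\<And>g. (\<lambda>k. pmf (ps k) g) \<longlonglongrightarrow> pmf p g"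
  shows "(\<lambda>k. \<integral>g. \<bar>pmf (ps k) g - pmf p g\<bar> \<partial>count_space UNIV) \<longlonglongrightarrow> 0"
proof -
  have "(\<lambda>k. \<integral>\<^sup>+g. norm (pmf (ps k) g - pmf p g) \<partial>count_space UNIV) \<longlonglongrightarrow> 0"
    by (rule Scheffe_lemma2) (use assms in \<open>auto simp: nn_integral_pmf integrable_pmf\<close>)
  also have "(\<lambda>k. \<integral>\<^sup>+g. norm (pmf (ps k) g - pmf p g) \<partial>count_space UNIV)
      = (\<lambda>k. ennreal (\<integral>g. \<bar>pmf (ps k) g - pmf p g\<bar> \<partial>count_space UNIV))"
    by (intro ext, subst nn_integral_eq_integral) (auto simp: integrable_pmf)
  finally have "(\<lambda>k. ennreal (\<integral>g. \<bar>pmf (ps k) g - pmf p g\<bar> \<partial>count_space UNIV)) \<longlonglongrightarrow> ennreal 0"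
    by simp
  then show ?thesis
    by (rule tendsto_ennrealD) (auto intro!: always_eventually Bochner_Integration.integral_nonneg)
qed

text \<open>The change of the measure costs at most its \<open>\<ell>\<^sup>1\<close> distance to the limit since the integrands
  are bounded by \<open>1\<close>; the change of the integrand is handled by dominated convergence under the limit
  measure.\<close>

lemma expectation_pmf_tendsto:
  fixes ps :: "nat \<Rightarrow> 'a pmf" and h :: "'a \<Rightarrow> real"
  assumes ps: "\<And>g. (\<lambda>k. pmf (ps k) g) \<longlonglongrightarrow> pmf p g"
    and h: "\<And>g. g \<in> set_pmf p \<Longrightarrow> (\<lambda>k. hs k g) \<longlonglongrightarrow> h g"
    and bound: "\<And>k g. \<bar>hs k g\<bar> \<le> 1"
  shows "(\<lambda>k. \<integral>g. hs k g \<partial>ps k) \<longlonglongrightarrow> (\<integral>g. h g \<partial>p)"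
proof -
  let ?d = "\<lambda>k. \<integral>g. \<bar>pmf (ps k) g - pmf p g\<bar> \<partial>count_space UNIV"
  have eq: "(\<integral>g. hs k g \<partial>q) = (\<integral>g. pmf q g * hs k g \<partial>count_space UNIV)" for q :: "'a pmf" and k
    by (simp add: measure_pmf_eq_density integral_density)
  have int: "integrable (count_space UNIV) (\<lambda>g. pmf q g * hs k g)" for q :: "'a pmf" and k
    by (rule Bochner_Integration.integrable_bound[OF integrable_pmf[of UNIV q]])
      (auto simp: abs_mult intro!: mult_left_le bound)
  have diff: "\<bar>(\<integral>g. hs k g \<partial>ps k) - (\<integral>g. hs k g \<partial>p)\<bar> \<le> ?d k" for k
  proof -
    have "(\<integral>g. hs k g \<partial>ps k) - (\<integral>g. hs k g \<partial>p)
        = (\<integral>g. pmf (ps k) g * hs k g - pmf p g * hs k g \<partial>count_space UNIV)"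
      unfolding eq by (rule Bochner_Integration.integral_diff[OF int int, symmetric])
    also have "\<bar>\<dots>\<bar> \<le> (\<integral>g. \<bar>pmf (ps k) g * hs k g - pmf p g * hs k g\<bar> \<partial>count_space UNIV)"
      by (rule integral_abs_bound)
    also have "\<dots> \<le> ?d k"
      by (intro integral_mono Bochner_Integration.integrable_abs Bochner_Integration.integrable_diff int integrable_pmf)
        (auto simp: left_diff_distrib[symmetric] abs_mult intro!: mult_left_le bound)
    finally show ?thesis .
  qed
  have "(\<lambda>k. (\<integral>g. hs k g \<partial>ps k) - (\<integral>g. hs k g \<partial>p)) \<longlonglongrightarrow> 0"
    by (rule Lim_null_comparison[OF _ integral_pmf_diff_tendsto[OF ps]])
      (use diff in auto)
  moreover have "(\<lambda>k. \<integral>g. hs k g \<partial>p) \<longlonglongrightarrow> (\<integral>g. h g \<partial>p)"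
    by (rule integral_dominated_convergence[where w = "\<lambda>_. 1"])
      (use h bound in \<open>auto intro!: AE_pmfI\<close>)
  ultimately show ?thesis using tendsto_add by fastforce
qed

context group
begin

lemma pmf_walk_Suc_integral:
  assumes p: "set_pmf p \<subseteq> carrier G" and x: "x \<in> carrier G"
  shows "pmf (walk_pmf G p (Suc n)) x = (\<integral>g. pmf (walk_pmf G p n) (x \<otimes> inv g) \<partial>p)"
proof -
  have "ennreal (pmf (walk_pmf G p (Suc n)) x) = ennreal (\<integral>g. pmf (walk_pmf G p n) (x \<otimes> inv g) \<partial>p)"
    unfolding pmf_walk_Suc[OF assms]
    by (intro nn_integral_eq_integral measure_pmf.integrable_const_bound[where B = 1])
      (auto simp: pmf_le_1)
  then show ?thesis by (simp add: Bochner_Integration.integral_nonneg del: walk_pmf.simps)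
qed

lemma pmf_walk_tendsto:
  assumes p: "set_pmf p \<subseteq> carrier G" and ps: "\<And>k. set_pmf (ps k) \<subseteq> carrier G"
    and lim: "\<And>g. (\<lambda>k. pmf (ps k) g) \<longlonglongrightarrow> pmf p g" and x: "x \<in> carrier G"
  shows "(\<lambda>k. pmf (walk_pmf G (ps k) n) x) \<longlonglongrightarrow> pmf (walk_pmf G p n) x"
  using x
proof (induction n arbitrary: x)
  case (Suc n)
  show ?case
    unfolding pmf_walk_Suc_integral[OF p Suc.prems] pmf_walk_Suc_integral[OF ps Suc.prems]
    using p Suc.prems by (intro expectation_pmf_tendsto lim Suc.IH) (auto simp: pmf_le_1)
qed simp

end

section \<open>The escape probability is the inverse of the Green function\<close>

text \<open>A measure on the subsets of the carrier is not a measure on the whole type, so the mass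
  function is extended by zero.\<close>

lemma prob_measure_on_pmf:
  assumes \<mu>: "prob_measure_on G \<mu>" and C: "countable (carrier G)"
  shows "\<exists>p. set_pmf p \<subseteq> carrier G \<and> (\<forall>g\<in>carrier G. pmf p g = measure \<mu> {g})"
proof -
  interpret prob_space \<mu> using \<mu> by (simp add: prob_measure_on_def)
  have sets: "sets \<mu> = Pow (carrier G)" using \<mu> by (simp add: prob_measure_on_def)
  then have space: "space \<mu> = carrier G" using sets_eq_imp_space_eq[of \<mu> "count_space (carrier G)"] by simp
  define f where "f g = (if g \<in> carrier G then measure \<mu> {g} else 0)" for g
  have "(\<integral>\<^sup>+g. ennreal (f g) \<partial>count_space UNIV) = (\<integral>\<^sup>+g. emeasure \<mu> {g} \<partial>count_space (carrier G))"
    by (simp add: nn_integral_count_space_indicator[of "carrier G"] f_def emeasure_eq_measure)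
      (auto intro!: nn_integral_cong simp: indicator_def)
  also have "\<dots> = emeasure \<mu> (carrier G)"
    by (rule emeasure_countable_singleton[symmetric]) (auto simp: sets C)
  also have "\<dots> = 1" using emeasure_space_1 by (simp add: space)
  finally have pmf: "pmf (embed_pmf f) g = f g" for g
    by (intro pmf_embed_pmf) (auto simp: f_def)
  show ?thesis
    by (rule exI[of _ "embed_pmf f"]) (auto simp: pmf set_pmf_eq f_def split: if_splits)
qed

context group
begin

context
  fixes \<mu> p
  assumes \<mu>: "prob_measure_on G \<mu>" and C: "countable (carrier G)"
    and p: "set_pmf p \<subseteq> carrier G" "\<And>g. g \<in> carrier G \<Longrightarrow> pmf p g = measure \<mu> {g}"
begin

abbreviation (input) "increments \<equiv> \<Pi>\<^sub>M i\<in>(UNIV :: nat set). \<mu>"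

lemma sets_prob_measure_on: "sets \<mu> = Pow (carrier G)"
  using \<mu> by (simp add: prob_measure_on_def)

lemma space_prob_measure_on: "space \<mu> = carrier G"
  using sets_eq_imp_space_eq[of \<mu> "count_space (carrier G)"] by (simp add: sets_prob_measure_on)

lemma sequence_space_prob_measure_on: "sequence_space \<mu>"
proof -
  interpret prob_space \<mu> using \<mu> by (simp add: prob_measure_on_def)
  show ?thesis
    unfolding sequence_space_def
    by (intro product_prob_space.intro product_prob_space_axioms.intro product_sigma_finite.intro
        prob_space_axioms sigma_finite_measure_axioms)
qed

lemma increments_in_carrier: "\<omega> \<in> space increments \<Longrightarrow> \<omega> i \<in> carrier G"
  by (auto simp: space_PiM space_prob_measure_on)

lemma walk_in_carrier: "\<omega> \<in> space increments \<Longrightarrow> walk G \<omega> n \<in> carrier G"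
  by (induction n) (auto simp: increments_in_carrier)

lemma measurable_increment: "(\<lambda>\<omega>. \<omega> i) \<in> measurable increments (count_space (carrier G))"
proof -
  have "(\<lambda>\<omega>. \<omega> i) \<in> measurable increments \<mu>" by measurable
  then show ?thesis
    by (subst measurable_cong_sets[OF refl, of _ \<mu>]) (auto simp: sets_prob_measure_on)
qed

lemma measurable_walk: "(\<lambda>\<omega>. walk G \<omega> n) \<in> measurable increments (count_space (carrier G))"
proof (induction n)
  case (Suc n)
  have "(\<lambda>\<omega>. x \<otimes> \<omega> n) \<in> measurable increments (count_space (carrier G))" if "x \<in> carrier G" for x
    using that by (intro measurable_compose[OF measurable_increment]) auto
  from measurable_compose_countable'[OF this Suc C] show ?case by simp
qed simp

lemma walk_event: "{\<omega> \<in> space increments. walk G \<omega> n = x} \<in> sets increments"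
proof -
  have "{\<omega> \<in> space increments. walk G \<omega> n = x}
      = (\<lambda>\<omega>. walk G \<omega> n) -` ({x} \<inter> carrier G) \<inter> space increments"
    using walk_in_carrier by auto
  then show ?thesis by (simp only:) (rule measurable_sets[OF measurable_walk], simp)
qed

lemma walk_comb_seq:
  assumes "\<omega> \<in> space increments" "\<omega>' \<in> space increments"
  shows "walk G (comb_seq n \<omega> \<omega>') (n + m) = walk G \<omega> n \<otimes> walk G \<omega>' m"
proof (induction m)
  case 0
  have "walk G (comb_seq n \<omega> \<omega>') k = walk G \<omega> k" if "k \<le> n" for k
    using that by (induction k) (auto simp: comb_seq_less)
  then show ?case using walk_in_carrier[OF assms(1)] by simp
next
  case (Suc m)
  then show ?case
    using assms comb_seq_add[of n \<omega> \<omega>' m]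
    by (simp add: m_assoc walk_in_carrier increments_in_carrier add.commute)
qed

lemma walk_comb_seq_prefix:
  assumes "\<omega> \<in> space increments" "\<omega>' \<in> space increments"
  shows "walk G (comb_seq n \<omega> \<omega>') n = walk G \<omega> n"
  using walk_comb_seq[OF assms, of n 0] walk_in_carrier[OF assms(1)] by simp

lemma comb_seq_in_space:
  "\<omega> \<in> space increments \<Longrightarrow> \<omega>' \<in> space increments \<Longrightarrow> comb_seq n \<omega> \<omega>' \<in> space increments"
  by (simp add: space_PiM PiE_iff comb_seq_def)

text \<open>An event that splits into a condition on the first \<open>n\<close> increments and one on the shifted
  sequence has product probability: gluing two independent increment sequences at time \<open>n\<close> yields
  an increment sequence of the same law.\<close>

lemma emeasure_comb_seq:
  assumes "A \<in> sets increments" "B \<in> sets increments" "E \<in> sets increments"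
    and E: "\<And>\<omega> \<omega>'. \<omega> \<in> space increments \<Longrightarrow> \<omega>' \<in> space increments \<Longrightarrow>
      comb_seq n \<omega> \<omega>' \<in> E \<longleftrightarrow> \<omega> \<in> A \<and> \<omega>' \<in> B"
  shows "emeasure increments E = emeasure increments A * emeasure increments B"
proof -
  interpret sequence_space \<mu> by (rule sequence_space_prob_measure_on)
  note AB = assms(1,2)[THEN sets.sets_into_space]
  have "emeasure increments E = emeasure (distr (increments \<Otimes>\<^sub>M increments) increments (\<lambda>(\<omega>, \<omega>'). comb_seq n \<omega> \<omega>')) E"
    by (simp only: PiM_comb_seq)
  also have "\<dots> = emeasure (increments \<Otimes>\<^sub>M increments)
      ((\<lambda>(\<omega>, \<omega>'). comb_seq n \<omega> \<omega>') -` E \<inter> space (increments \<Otimes>\<^sub>M increments))"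
    by (rule emeasure_distr[OF measurable_comb_seq assms(3)])
  also have "(\<lambda>(\<omega>, \<omega>'). comb_seq n \<omega> \<omega>') -` E \<inter> space (increments \<Otimes>\<^sub>M increments) = A \<times> B"
    using E AB by (auto simp: space_pair_measure E[OF subsetD[OF AB(1)] subsetD[OF AB(2)]])
  also have "emeasure (increments \<Otimes>\<^sub>M increments) (A \<times> B) = emeasure increments A * emeasure increments B"
    by (rule P.emeasure_pair_measure_Times) (use assms in auto)
  finally show ?thesis .
qed

lemma emeasure_walk:
  assumes "x \<in> carrier G"
  shows "emeasure increments {\<omega> \<in> space increments. walk G \<omega> n = x} = pmf (walk_pmf G p n) x"
  using assms
proof (induction n arbitrary: x)
  case 0
  interpret sequence_space \<mu> by (rule sequence_space_prob_measure_on)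
  show ?case by (cases "x = \<one>") (auto simp: P.emeasure_space_1 indicator_def)
next
  case (Suc n)
  interpret sequence_space \<mu> by (rule sequence_space_prob_measure_on)
  let ?A = "\<lambda>y. {\<omega> \<in> space increments. walk G \<omega> n = y}"
  let ?B = "\<lambda>g i. {\<omega> \<in> space increments. \<omega> i = g}"
  have B: "?B g i \<in> sets increments" if "g \<in> carrier G" for g i
  proof -
    have "?B g i = (\<lambda>\<omega>. \<omega> i) -` {g} \<inter> space increments" by auto
    then show ?thesis using measurable_sets[OF measurable_increment, of "{g}" i] that by simp
  qed
  have B0: "emeasure increments (?B g 0) = pmf p g" if g: "g \<in> carrier G" for g
  proof -
    have "emeasure increments (?B g 0) = emeasure (distr increments \<mu> (\<lambda>\<omega>. \<omega> 0)) {g}"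
      using g by (subst emeasure_distr) (auto simp: sets_prob_measure_on intro!: arg_cong[where f = "emeasure increments"])
    also have "distr increments \<mu> (\<lambda>\<omega>. \<omega> 0) = \<mu>"
      by (rule distr_PiM_component) (auto intro: prob_space)
    finally show ?thesis using p(2)[OF g] by (simp add: M.emeasure_eq_measure)
  qed
  let ?E = "\<lambda>g. ?A (x \<otimes> inv g) \<inter> ?B g n"
  have E: "?E g \<in> sets increments" if "g \<in> carrier G" for g
    using walk_event B[OF that] by auto
  have "{\<omega> \<in> space increments. walk G \<omega> (Suc n) = x} = (\<Union>g\<in>carrier G. ?E g)"
  proof (intro Set.set_eqI iffI)
    fix \<omega> assume "\<omega> \<in> {\<omega> \<in> space increments. walk G \<omega> (Suc n) = x}"
    then have \<omega>: "\<omega> \<in> space increments" "x = walk G \<omega> n \<otimes> \<omega> n" by auto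
    then have "\<omega> \<in> ?E (\<omega> n)"
      using walk_in_carrier[OF \<omega>(1), of n] increments_in_carrier[OF \<omega>(1), of n] by (simp add: m_assoc)
    then show "\<omega> \<in> (\<Union>g\<in>carrier G. ?E g)" using increments_in_carrier[OF \<omega>(1), of n] by blast
  qed (use Suc.prems in \<open>auto simp: m_assoc\<close>)
  then have "emeasure increments {\<omega> \<in> space increments. walk G \<omega> (Suc n) = x}
      = (\<integral>\<^sup>+g. emeasure increments (?E g) \<partial>count_space (carrier G))"
    using E C by (simp only:, intro emeasure_UN_countable) (auto simp: disjoint_family_on_def)
  also have "\<dots> = (\<integral>\<^sup>+g. ennreal (pmf p g) * ennreal (pmf (walk_pmf G p n) (x \<otimes> inv g)) \<partial>count_space (carrier G))"
  proof (intro nn_integral_cong)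
    fix g assume "g \<in> space (count_space (carrier G))"
    then have g: "g \<in> carrier G" by simp
    have "emeasure increments (?E g) = emeasure increments (?A (x \<otimes> inv g)) * emeasure increments (?B g 0)"
    proof (rule emeasure_comb_seq[where n = n, OF walk_event B[OF g] E[OF g]])
      fix \<omega> \<omega>' assume \<omega>: "\<omega> \<in> space increments" "\<omega>' \<in> space increments"
      have "comb_seq n \<omega> \<omega>' n = \<omega>' 0" by (simp add: comb_seq_def)
      then show "comb_seq n \<omega> \<omega>' \<in> ?E g \<longleftrightarrow> \<omega> \<in> ?A (x \<otimes> inv g) \<and> \<omega>' \<in> ?B g 0"
        using \<omega> comb_seq_in_space[OF \<omega>] walk_comb_seq_prefix[OF \<omega>] by auto
    qed
    also have "\<dots> = ennreal (pmf p g) * ennreal (pmf (walk_pmf G p n) (x \<otimes> inv g))"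
      using Suc.IH[of "x \<otimes> inv g"] Suc.prems g B0[OF g] by (simp add: mult.commute)
    finally show "emeasure increments (?E g) = ennreal (pmf p g) * ennreal (pmf (walk_pmf G p n) (x \<otimes> inv g))" .
  qed
  also have "\<dots> = pmf (walk_pmf G p (Suc n)) x"
    unfolding pmf_walk_Suc[OF p(1) Suc.prems] nn_integral_pmf_on[OF p(1)] ..
  finally show ?case .
qed

text \<open>If the series converges, then by the Borel--Cantelli lemma the identity is almost surely visited
  finitely often, and it is visited at time \<open>0\<close>, so there is a last visit. The last visit happens at
  time \<open>n\<close> when the walk is at the identity at time \<open>n\<close> and the walk driven by the later increments
  never returns; these two events are independent, and the second has the escape probability.\<close>

lemma escape_prob_times_green:
  assumes summable: "summable (\<lambda>n. pmf (walk_pmf G p n) \<one>)"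
  shows "escape_prob G \<mu> * suminf (\<lambda>n. pmf (walk_pmf G p n) \<one>) = 1"
proof -
  interpret sequence_space \<mu> by (rule sequence_space_prob_measure_on)
  let ?A = "\<lambda>n. {\<omega> \<in> space increments. walk G \<omega> n = \<one>}"
  let ?esc = "{\<omega> \<in> space increments. \<forall>n\<ge>1. walk G \<omega> n \<noteq> \<one>}"
  let ?L = "\<lambda>n. {\<omega> \<in> space increments. walk G \<omega> n = \<one> \<and> (\<forall>m>n. walk G \<omega> m \<noteq> \<one>)}"
  have A: "measure increments (?A n) = pmf (walk_pmf G p n) \<one>" for n
    using emeasure_walk[OF one_closed, of n] by (simp add: P.emeasure_eq_measure)
  have "?esc = space increments - (\<Union>n\<in>{1..}. ?A n)" by auto
  then have esc: "?esc \<in> sets increments" using walk_event by auto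
  have "?L n = ?A n - (\<Union>m\<in>{n<..}. ?A m)" for n by auto
  then have L: "?L n \<in> sets increments" for n using walk_event by auto
  have "emeasure increments (?L n) = emeasure increments (?A n) * emeasure increments ?esc" for n
  proof (rule emeasure_comb_seq[where n = n, OF walk_event esc L])
    fix \<omega> \<omega>' assume \<omega>: "\<omega> \<in> space increments" "\<omega>' \<in> space increments"
    have "(\<forall>m>n. walk G (comb_seq n \<omega> \<omega>') m \<noteq> \<one>) \<longleftrightarrow> (\<forall>m\<ge>1. walk G \<omega>' m \<noteq> \<one>)"
      if "walk G \<omega> n = \<one>"
    proof -
      have eq: "walk G (comb_seq n \<omega> \<omega>') (n + m) = walk G \<omega>' m" for m
        using walk_comb_seq[OF \<omega>, of n m] that walk_in_carrier[OF \<omega>(2)] by simp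
      show ?thesis
      proof (intro iffI allI impI)
        fix m :: nat assume "\<forall>m>n. walk G (comb_seq n \<omega> \<omega>') m \<noteq> \<one>" "m \<ge> 1"
        then show "walk G \<omega>' m \<noteq> \<one>" using eq[of m] by auto
      next
        fix m assume "\<forall>m\<ge>1. walk G \<omega>' m \<noteq> \<one>" "m > n"
        then show "walk G (comb_seq n \<omega> \<omega>') m \<noteq> \<one>" using eq[of "m - n"] by auto
      qed
    qed
    then show "comb_seq n \<omega> \<omega>' \<in> ?L n \<longleftrightarrow> \<omega> \<in> ?A n \<and> \<omega>' \<in> ?esc"
      using \<omega> comb_seq_in_space[OF \<omega>] walk_comb_seq_prefix[OF \<omega>] by auto
  qed
  then have mL: "measure increments (?L n) = pmf (walk_pmf G p n) \<one> * escape_prob G \<mu>" for n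
    by (simp add: P.emeasure_eq_measure A escape_prob_def ennreal_mult''[symmetric])
  have disj: "disjoint_family ?L"
    unfolding disjoint_family_on_def
  proof (intro ballI impI, rule ccontr)
    fix m n assume "m \<noteq> n" "?L m \<inter> ?L n \<noteq> {}"
    then show False by (cases m n rule: linorder_cases) auto
  qed
  have "AE \<omega> in increments. eventually (\<lambda>n. \<omega> \<in> space increments - ?A n) sequentially"
    using summable walk_event by (intro borel_cantelli_AE1) (auto simp: A P.emeasure_eq_measure)
  with AE_space have "AE \<omega> in increments. \<omega> \<in> (\<Union>n. ?L n)"
  proof eventually_elim
    case \<omega>: (elim \<omega>)
    then obtain N where N: "\<And>n. n \<ge> N \<Longrightarrow> walk G \<omega> n \<noteq> \<one>" by (auto simp: eventually_sequentially)
    define n where "n = Max {n. walk G \<omega> n = \<one>}"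
    have fin: "finite {n. walk G \<omega> n = \<one>}"
    proof (rule finite_subset)
      show "{n. walk G \<omega> n = \<one>} \<subseteq> {..N}"
        using N nat_le_linear by blast
    qed simp
    have "0 \<in> {n. walk G \<omega> n = \<one>}" by simp
    then have "n \<in> {n. walk G \<omega> n = \<one>}" unfolding n_def by (intro Max_in fin) blast
    moreover have "walk G \<omega> m \<noteq> \<one>" if "m > n" for m
      using Max_ge[OF fin, of m] that unfolding n_def by auto
    ultimately show "\<omega> \<in> (\<Union>n. ?L n)" using \<omega>(1) by auto
  qed
  then have "measure increments (\<Union>n. ?L n) = 1"
    using L by (subst P.prob_eq_1) auto
  moreover have "(\<lambda>n. measure increments (?L n)) sums measure increments (\<Union>n. ?L n)"
    using L disj by (intro P.finite_measure_UNION) auto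
  ultimately have "(\<lambda>n. pmf (walk_pmf G p n) \<one> * escape_prob G \<mu>) sums 1"
    by (simp add: mL)
  moreover have "(\<lambda>n. pmf (walk_pmf G p n) \<one> * escape_prob G \<mu>) sums
      (suminf (\<lambda>n. pmf (walk_pmf G p n) \<one>) * escape_prob G \<mu>)"
    using summable by (intro sums_mult2) (rule summable_sums)
  ultimately show ?thesis by (simp add: sums_unique2 mult.commute)
qed

end
end

section \<open>Continuity of the escape probability\<close>

text \<open>A bound on all finite blocks of a nonnegative series gives both its convergence and the rate
  at which its partial sums approach the sum.\<close>

lemma suminf_tail_bound:
  fixes f :: "nat \<Rightarrow> real"
  assumes f: "\<And>n. 0 \<le> f n" and b: "\<And>N M. sum f {N..<M} \<le> b N"
  shows "summable f" "\<bar>suminf f - sum f {..<N}\<bar> \<le> b N"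
proof -
  show summable: "summable f"
    using b[of 0] by (intro summableI_nonneg_bounded[where x = "b 0"] f) (simp add: lessThan_atLeast0)
  have "suminf f - sum f {..<N} = suminf (\<lambda>n. f (n + N))"
    using suminf_split_initial_segment[OF summable, of N] by simp
  moreover have "suminf (\<lambda>n. f (n + N)) \<le> b N"
  proof (rule suminf_le_const)
    show "summable (\<lambda>n. f (n + N))" using summable by (rule summable_ignore_initial_segment)
    show "(\<Sum>i<n. f (i + N)) \<le> b N" for n
      using b[of N "n + N"] sum.shift_bounds_nat_ivl[of f 0 N n] by (simp add: lessThan_atLeast0)
  qed
  moreover have "0 \<le> suminf (\<lambda>n. f (n + N))"
    using summable_ignore_initial_segment[OF summable, of N] f by (intro suminf_nonneg)
  ultimately show "\<bar>suminf f - sum f {..<N}\<bar> \<le> b N" by simp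
qed

lemma suminf_tendsto_uniform_tail:
  fixes q :: "nat \<Rightarrow> nat \<Rightarrow> real"
  assumes q: "\<And>k n. 0 \<le> q k n" and f: "\<And>n. 0 \<le> f n"
    and lim: "\<And>n. (\<lambda>k. q k n) \<longlonglongrightarrow> f n"
    and tail_q: "eventually (\<lambda>k. \<forall>N M. sum (q k) {N..<M} \<le> b N) sequentially"
    and tail_f: "\<And>N M. sum f {N..<M} \<le> b N" and b: "b \<longlonglongrightarrow> 0"
  shows "(\<lambda>k. suminf (q k)) \<longlonglongrightarrow> suminf f"
proof (rule tendstoI)
  fix e :: real assume e: "e > 0"
  then obtain N where N: "b N < e / 3"
    using order_tendstoD(2)[OF b, of "e / 3"] by (auto simp: eventually_sequentially)
  have "(\<lambda>k. sum (q k) {..<N}) \<longlonglongrightarrow> sum f {..<N}"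
    by (intro tendsto_sum lim)
  then have "eventually (\<lambda>k. dist (sum (q k) {..<N}) (sum f {..<N}) < e / 3) sequentially"
    using e by (intro tendstoD) auto
  with tail_q show "eventually (\<lambda>k. dist (suminf (q k)) (suminf f) < e) sequentially"
  proof eventually_elim
    case (elim k)
    have "\<bar>suminf (q k) - sum (q k) {..<N}\<bar> \<le> b N"
      using elim(1) by (intro suminf_tail_bound q) auto
    moreover have "\<bar>suminf f - sum f {..<N}\<bar> \<le> b N"
      by (intro suminf_tail_bound f tail_f)
    ultimately show ?case using elim(2) N unfolding dist_real_def by linarith
  qed
qed

context group
begin

text \<open>The constant \<open>a\<close> is at most half of the mass that \<open>p\<close> gives to any element of \<open>F\<close>, so that the
  tail bound with this \<open>a\<close> holds for \<open>p\<close> itself and, since \<open>F\<close> is finite, for all but finitely many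
  members of the sequence.\<close>

lemma green_function_tendsto:
  assumes C: "countable (carrier G)" and p: "set_pmf p \<subseteq> carrier G"
    and growth: "finite S" "S \<subseteq> semigroup_generated G (set_pmf p)" "S \<noteq> {}"
      "\<forall>n\<ge>1. c * real n ^ 3 \<le> real (card (set_power G S n))" "c > 0"
    and ps: "\<And>k. set_pmf (ps k) \<subseteq> carrier G"
    and lim: "\<And>g. (\<lambda>k. pmf (ps k) g) \<longlonglongrightarrow> pmf p g"
  shows "summable (\<lambda>n. pmf (walk_pmf G p n) \<one>)"
    and "eventually (\<lambda>k. summable (\<lambda>n. pmf (walk_pmf G (ps k) n) \<one>)) sequentially"
    and "(\<lambda>k. suminf (\<lambda>n. pmf (walk_pmf G (ps k) n) \<one>)) \<longlonglongrightarrow> suminf (\<lambda>n. pmf (walk_pmf G p n) \<one>)"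
proof -
  obtain F K where F: "finite F" "F \<subseteq> set_pmf p" and K: "K > 0" "S \<subseteq> set_power G (insert \<one> F) K"
    using finite_subset_semigroup_generated[OF p growth(1,2)] by auto
  have T: "insert \<one> F \<subseteq> carrier G" using F p by auto
  \<comment> \<open>Inserting \<open>1\<close> keeps the minimum meaningful when \<open>F\<close> is empty.\<close>
  define a where "a = Min (insert 1 (pmf p ` F)) / 2"
  have a0: "a > 0" using F by (auto simp: a_def pmf_positive_iff subset_iff)
  have aF: "a < pmf p g" if "g \<in> F" for g
  proof -
    have "2 * a \<le> pmf p g" using F that by (simp add: a_def)
    then show ?thesis using a0 by simp
  qed
  define L where "L = nash_const (2 * (real K)\<^sup>2 / a) (1 / c)"
  define b where "b N = 2 * L * root 3 (L / real (Suc (N div 2)))" for N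
  have bound: "(\<Sum>n\<in>{N..<M}. pmf (walk_pmf G q n) \<one>) \<le> b N"
    if "set_pmf q \<subseteq> carrier G" "\<And>g. g \<in> F \<Longrightarrow> a \<le> pmf q g" for q N M
    unfolding b_def L_def
    by (rule sum_return_prob_le[OF C that(1) T _ a0, of "set_power G S"])
      (use that(2) growth K set_power_mult_subset[OF T K(2)] set_power_finite_nonempty(1)[OF growth(1,3), of G] in auto)
  have "filterlim (\<lambda>N. Suc (N div 2)) at_top sequentially"
    unfolding filterlim_at_top eventually_sequentially
    by (intro allI, rule_tac x = "2 * Z" in exI) auto
  then have "(\<lambda>N. L / real (Suc (N div 2))) \<longlonglongrightarrow> 0"
    by (intro real_tendsto_divide_at_top[OF tendsto_const] filterlim_compose[OF filterlim_real_sequentially])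
  then have "(\<lambda>N. root 3 (L / real (Suc (N div 2)))) \<longlonglongrightarrow> root 3 0"
    by (rule tendsto_real_root)
  then have b: "b \<longlonglongrightarrow> 0"
    unfolding b_def using tendsto_mult_right_zero[of _ sequentially "2 * L"] by simp
  have tail_p: "sum (\<lambda>n. pmf (walk_pmf G p n) \<one>) {N..<M} \<le> b N" for N M
    using aF by (intro bound p) (auto intro: less_imp_le)
  have "eventually (\<lambda>k. \<forall>g\<in>F. a < pmf (ps k) g) sequentially"
    using F(1) aF lim by (intro eventually_ball_finite ballI order_tendstoD(1)) auto
  then have tail_ps: "eventually (\<lambda>k. \<forall>N M. sum (\<lambda>n. pmf (walk_pmf G (ps k) n) \<one>) {N..<M} \<le> b N) sequentially"
  proof eventually_elim
    case (elim k)
    then show ?case by (intro allI bound ps) (auto intro: less_imp_le)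
  qed
  show "summable (\<lambda>n. pmf (walk_pmf G p n) \<one>)"
    using tail_p by (intro suminf_tail_bound(1)[where b = b]) auto
  show "eventually (\<lambda>k. summable (\<lambda>n. pmf (walk_pmf G (ps k) n) \<one>)) sequentially"
    using tail_ps by eventually_elim (intro suminf_tail_bound(1)[where b = b], auto)
  show "(\<lambda>k. suminf (\<lambda>n. pmf (walk_pmf G (ps k) n) \<one>)) \<longlonglongrightarrow> suminf (\<lambda>n. pmf (walk_pmf G p n) \<one>)"
    by (rule suminf_tendsto_uniform_tail[OF _ _ _ tail_ps tail_p b])
      (auto intro: pmf_walk_tendsto[OF p ps lim])
qed

end

theorem theorem1p4:
  fixes G :: "('a, 'b) monoid_scheme"
    and \<mu> :: "'a measure"
    and \<mu>s :: "nat \<Rightarrow> 'a measure"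
  assumes "group G"
    and "countable (carrier G)"
    and "prob_measure_on G \<mu>"
    and "\<exists>H. subgroup H G \<and> H \<subseteq> semigroup_generated G (supp \<mu>)
           \<and> finitely_generated_group (G\<lparr>carrier := H\<rparr>)
           \<and> at_least_cubic_growth (G\<lparr>carrier := H\<rparr>)"
    and "\<And>k. k \<ge> 1 \<Longrightarrow> prob_measure_on G (\<mu>s k)"
    and "\<And>g. g \<in> carrier G \<Longrightarrow> (\<lambda>k. measure (\<mu>s k) {g}) \<longlonglongrightarrow> measure \<mu> {g}"
  shows "(\<lambda>k. escape_prob G (\<mu>s k)) \<longlonglongrightarrow> escape_prob G \<mu>"
proof -
  interpret group G by fact
  note C = assms(2)
  obtain p where p: "set_pmf p \<subseteq> carrier G" "\<And>g. g \<in> carrier G \<Longrightarrow> pmf p g = measure \<mu> {g}"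
    using prob_measure_on_pmf[OF assms(3) C] by auto
  \<comment> \<open>The sequence starts at index \<open>1\<close>; the law at index \<open>0\<close> is arbitrary and is filled with \<open>p\<close>.\<close>
  have "\<exists>q. set_pmf q \<subseteq> carrier G \<and> (k \<ge> 1 \<longrightarrow> (\<forall>g\<in>carrier G. pmf q g = measure (\<mu>s k) {g}))" for k
  proof (cases "k \<ge> 1")
    case True
    then show ?thesis using prob_measure_on_pmf[OF assms(5)[OF True] C] by auto
  qed (use p(1) in auto)
  then obtain ps where ps: "\<And>k. set_pmf (ps k) \<subseteq> carrier G"
    "\<And>k g. k \<ge> 1 \<Longrightarrow> g \<in> carrier G \<Longrightarrow> pmf (ps k) g = measure (\<mu>s k) {g}"
    by metis
  have lim: "(\<lambda>k. pmf (ps k) g) \<longlonglongrightarrow> pmf p g" for g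
  proof (cases "g \<in> carrier G")
    case True
    have "eventually (\<lambda>k. measure (\<mu>s k) {g} = pmf (ps k) g) sequentially"
      using eventually_ge_at_top[of "1::nat"] by eventually_elim (simp add: ps(2) True)
    with assms(6)[OF True] show ?thesis
      unfolding p(2)[OF True] by (rule Lim_transform_eventually)
  next
    case False
    then have "pmf q g = 0" if "set_pmf q \<subseteq> carrier G" for q
      using that by (auto simp: set_pmf_iff)
    then show ?thesis using p(1) ps(1) by simp
  qed
  have "g \<in> supp \<mu> \<longleftrightarrow> g \<in> carrier G \<and> 0 < pmf p g" for g
    using p(2)[of g] by (auto simp: supp_def space_prob_measure_on[OF assms(3) C p])
  then have "supp \<mu> = set_pmf p"
    using p(1) unfolding pmf_positive_iff by blast
  with assms(4) obtain H where H: "H \<subseteq> semigroup_generated G (set_pmf p)"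
    "at_least_cubic_growth (G\<lparr>carrier := H\<rparr>)" by auto
  obtain S c where S: "finite S" "S \<subseteq> H" "S \<noteq> {}" "c > 0"
    "\<forall>n\<ge>1. c * real n ^ 3 \<le> real (card (set_power G S n))"
    using at_least_cubic_growth_card[OF H(2)] unfolding set_power_restrict by auto
  let ?g = "\<lambda>q. suminf (\<lambda>n. pmf (walk_pmf G q n) \<one>\<^bsub>G\<^esub>)"
  note green = green_function_tendsto[OF C p(1) S(1) order_trans[OF S(2) H(1)] S(3,5,4) ps(1) lim]
  have esc: "escape_prob G \<mu> * ?g p = 1"
    by (rule escape_prob_times_green[OF assms(3) C p green(1)])
  have "eventually (\<lambda>k. inverse (?g (ps k)) = escape_prob G (\<mu>s k)) sequentially"
    using green(2) eventually_ge_at_top[of "1::nat"]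
  proof eventually_elim
    case (elim k)
    have "escape_prob G (\<mu>s k) * ?g (ps k) = 1"
      by (rule escape_prob_times_green[OF assms(5)[OF elim(2)] C ps(1) ps(2)[OF elim(2)] elim(1)])
    then show ?case by (metis inverse_unique mult.commute)
  qed
  moreover have "(\<lambda>k. inverse (?g (ps k))) \<longlonglongrightarrow> inverse (?g p)"
    using esc by (intro tendsto_inverse green(3)) auto
  moreover have "inverse (?g p) = escape_prob G \<mu>"
    using esc by (metis inverse_unique mult.commute)
  ultimately show ?thesis using Lim_transform_eventually by fastforce
qed

end
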